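(* Let $I:S^{2n+1}\to S^{2n+1}$ be the identity map of the standard odd-dimensional sphere, regarded as a pseudoharmonic map. If $n\ge1$, then $\mathrm{index}(I)\ge 2n+2$, where $\mathrm{index}(I)$ is the dimension of the largest subspace of $\Gamma(TS^{2n+1})$ on which $H_I$ is negative (definite).
   Context: The unit sphere $S^{2n+1}\subset\mathbb C^{n+1}$ carries the induced CR structure $T_{1,0}=T^{1,0}(\mathbb C^{n+1})\cap(TS^{2n+1}\otimes\mathbb C)$, with Levi distribution $\widetilde H=\mathrm{Re}(T_{1,0}\oplus\overline{T_{1,0}})$, complex structure $\widetilde J$ on $\widetilde H$ induced from $\mathbb C^{n+1}$, and the standard pseudo-Hermitian structure $\widetilde\theta$, with $\ker\widetilde\theta=\widetilde H$, whose characteristic direction is $\widetilde T=\widehat J\nu$ ($\widehat J$ the complex structure of $\mathbb C^{n+1}$, $\nu$ the exterior unit normal; $\widetilde\theta(\widetilde T)=1$, $d\widetilde\theta(\widetilde T,\cdot)=0$), and whose Webster metric $g_{\widetilde\theta}=\langle\cdot,\cdot\rangle$ (equal to $\frac12d\widetilde\theta(\cdot,\widetilde J\cdot)$ on $\widetilde H$, with $\widetilde T$ unit and orthogonal to $\widetilde H$) is the round metric; here $d\widetilde\theta(X,Y)=X\widetilde\theta(Y)-Y\widetilde\theta(X)-\widetilde\theta([X,Y])$. Extend $\widetilde J\widetilde T=0$. It is Sasakian (zero pseudo-Hermitian torsion). The Tanaka-Webster connection $\widetilde\nabla$ is the unique linear connection for which $\widetilde H$, $\widetilde J$ and $g_{\widetilde\theta}$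 are parallel, and whose torsion satisfies $T_{\widetilde\nabla}(X,Y)=d\widetilde\theta(X,Y)\widetilde T$ for $X,Y\in\widetilde H$ and $T_{\widetilde\nabla}(\widetilde T,\cdot)=0$. Its curvature is $\widetilde R(X,Y)Z=\widetilde\nabla_X\widetilde\nabla_YZ-\widetilde\nabla_Y\widetilde\nabla_XZ-\widetilde\nabla_{[X,Y]}Z$, and $\widetilde R(X,Y,Z,W)=-\langle\widetilde R(X,Y)Z,W\rangle$. For $V\in\Gamma(TS^{2n+1})$ write $V_{\widetilde H}=V-\langle V,\widetilde T\rangle\widetilde T$. The second variation form (Hessian at $I$ of the horizontal energy $E_{H,\widetilde H}(f)=\frac12\int\sum_\lambda|\pi_{\widetilde H}df(e_\lambda)|^2dV_{\widetilde\theta}$) is $$H_I(V,V)=\int_{S^{2n+1}}\sum_{\lambda=1}^{2n}\big[\langle\widetilde\nabla_{e_\lambda}V_{\widetilde H},\widetilde\nabla_{e_\lambda}V_{\widetilde H}\rangle-\widetilde R(V,e_\lambda,V,e_\lambda)\big]dV_{\widetilde\theta},$$ with $\{e_\lambda\}_{\lambda=1}^{2n}$ a local orthonormal frame of $\widetilde H$ and $dV_{\widetilde\theta}$ the Riemannian volume of $g_{\widetilde\theta}$. *)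

theory Defs
  imports "HOL-Analysis.Analysis" "HOL-Library.Function_Algebras" "HOL-Library.Extended_Nat"
begin

text \<open>The pointwise real vector space structure on functions; it makes \<open>subspace\<close> and \<open>dim\<close>
  available for sets of vector fields.\<close>

instantiation "fun" :: (type, scaleR) scaleR
begin
definition scaleR_fun_def: "r *\<^sub>R f = (\<lambda>x. r *\<^sub>R f x)"
instance ..
end

instance "fun" :: (type, real_vector) real_vector
  by standard
    (simp_all add: scaleR_fun_def plus_fun_def fun_eq_iff scaleR_right_distrib scaleR_left_distrib)

text \<open>Throughout, \<open>\<complex>\<^bsup>n+1\<^esup>\<close> is \<^typ>\<open>complex ^ 'm\<close> with \<open>CARD('m) = n + 1\<close>, and the inner product of
  that type is the real part of the standard Hermitian product.\<close>

type_synonym 'm cfield = "complex ^ 'm \<Rightarrow> complex ^ 'm"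

abbreviation usphere :: "'a::real_normed_vector set" where
  "usphere \<equiv> sphere 0 1"

subsection \<open>Smooth functions and vector fields on the sphere\<close>

primrec ck_on :: "nat \<Rightarrow> 'a::euclidean_space set \<Rightarrow> ('a \<Rightarrow> 'b::real_normed_vector) \<Rightarrow> bool" where
  "ck_on 0 U f \<longleftrightarrow> continuous_on U f"
| "ck_on (Suc k) U f \<longleftrightarrow>
    f differentiable_on U \<and> (\<forall>v. ck_on k U (\<lambda>x. frechet_derivative f (at x) v))"

definition smooth_on_sphere :: "('a::euclidean_space \<Rightarrow> 'b::real_normed_vector) \<Rightarrow> bool" where
  "smooth_on_sphere f \<longleftrightarrow>
    (\<forall>p\<in>usphere. \<exists>U F. open U \<and> p \<in> U \<and> (\<forall>k. ck_on k U F) \<and> (\<forall>x\<in>U \<inter> usphere. F x = f x))"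

text \<open>Sections of the tangent bundle of the sphere. Values off the sphere are irrelevant; they are
  fixed to be 0 so that a section is determined by its values on the sphere.\<close>

definition vector_fields :: "'m::finite cfield set" where
  "vector_fields =
    {V. smooth_on_sphere V \<and> (\<forall>p\<in>usphere. V p \<bullet> p = 0) \<and> (\<forall>p. p \<notin> usphere \<longrightarrow> V p = 0)}"

text \<open>The derivative \<open>X f\<close>. A derivative of \<open>f\<close> within the sphere is only determined on tangent
  vectors, but \<open>X p\<close> is one.\<close>

definition dir_deriv ::
  "'m::finite cfield \<Rightarrow> (complex ^ 'm \<Rightarrow> 'b::real_normed_vector) \<Rightarrow> complex ^ 'm \<Rightarrow> 'b" where
  "dir_deriv X f p =
    (if p \<in> usphere then frechet_derivative f (at p within usphere) (X p) else 0)"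

definition lie_bracket :: "'m::finite cfield \<Rightarrow> 'm cfield \<Rightarrow> 'm cfield" where
  "lie_bracket X Y = dir_deriv X Y - dir_deriv Y X"

subsection \<open>The standard pseudo-Hermitian structure\<close>

definition mult_i :: "complex ^ 'm::finite \<Rightarrow> complex ^ 'm" where
  "mult_i v = (\<chi> k. \<i> * v $ k)"

text \<open>The exterior unit normal at \<open>p\<close> is \<open>p\<close> itself.\<close>

definition char_dir :: "'m::finite cfield" where
  "char_dir p = (if p \<in> usphere then mult_i p else 0)"

text \<open>A vector of \<open>T\<^bsup>1,0\<^esup>(\<complex>\<^bsup>n+1\<^esup>)\<close> has the form \<open>v - \<i> mult_i v\<close> with \<open>v\<close> real, and it
  lies in the complexified tangent space of the sphere iff both \<open>v\<close> and \<open>mult_i v\<close> are tangent.\<close>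

definition horizontal_fields :: "'m::finite cfield set" where
  "horizontal_fields = {V \<in> vector_fields. \<forall>p\<in>usphere. mult_i (V p) \<bullet> p = 0}"

text \<open>The Webster metric is the round one, so it is the ambient inner product.\<close>

definition theta :: "'m::finite cfield \<Rightarrow> complex ^ 'm \<Rightarrow> real" where
  "theta X p = X p \<bullet> char_dir p"

definition dtheta :: "'m::finite cfield \<Rightarrow> 'm cfield \<Rightarrow> complex ^ 'm \<Rightarrow> real" where
  "dtheta X Y p =
    dir_deriv X (theta Y) p - dir_deriv Y (theta X) p - theta (lie_bracket X Y) p"

definition hor :: "'m::finite cfield \<Rightarrow> 'm cfield" where
  "hor V p = V p - (V p \<bullet> char_dir p) *\<^sub>R char_dir p"

text \<open>The complex structure of the Levi distribution, extended by 0 on the characteristic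
  direction.\<close>

definition cr_J :: "'m::finite cfield \<Rightarrow> 'm cfield" where
  "cr_J V p = mult_i (hor V p)"

subsection \<open>The Tanaka-Webster connection\<close>

definition linear_connection :: "('m::finite cfield \<Rightarrow> 'm cfield \<Rightarrow> 'm cfield) \<Rightarrow> bool" where
  "linear_connection D \<longleftrightarrow>
    (\<forall>X\<in>vector_fields. \<forall>Y\<in>vector_fields. D X Y \<in> vector_fields) \<and>
    (\<forall>X\<in>vector_fields. \<forall>X'\<in>vector_fields. \<forall>Y\<in>vector_fields. D (X + X') Y = D X Y + D X' Y) \<and>
    (\<forall>X\<in>vector_fields. \<forall>Y\<in>vector_fields. \<forall>Y'\<in>vector_fields. D X (Y + Y') = D X Y + D X Y') \<and>
    (\<forall>f :: complex ^ 'm \<Rightarrow> real. smooth_on_sphere f \<longrightarrow>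
      (\<forall>X\<in>vector_fields. \<forall>Y\<in>vector_fields.
        D (\<lambda>p. f p *\<^sub>R X p) Y = (\<lambda>p. f p *\<^sub>R D X Y p) \<and>
        D X (\<lambda>p. f p *\<^sub>R Y p) = (\<lambda>p. dir_deriv X f p *\<^sub>R Y p + f p *\<^sub>R D X Y p)))"

definition torsion ::
  "('m::finite cfield \<Rightarrow> 'm cfield \<Rightarrow> 'm cfield) \<Rightarrow> 'm cfield \<Rightarrow> 'm cfield \<Rightarrow> 'm cfield" where
  "torsion D X Y = D X Y - D Y X - lie_bracket X Y"

definition curvature ::
  "('m::finite cfield \<Rightarrow> 'm cfield \<Rightarrow> 'm cfield) \<Rightarrow>
    'm cfield \<Rightarrow> 'm cfield \<Rightarrow> 'm cfield \<Rightarrow> 'm cfield" where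
  "curvature D X Y Z = D X (D Y Z) - D Y (D X Z) - D (lie_bracket X Y) Z"

definition curvature4 ::
  "('m::finite cfield \<Rightarrow> 'm cfield \<Rightarrow> 'm cfield) \<Rightarrow>
    'm cfield \<Rightarrow> 'm cfield \<Rightarrow> 'm cfield \<Rightarrow> 'm cfield \<Rightarrow> complex ^ 'm \<Rightarrow> real" where
  "curvature4 D X Y Z W p = - (curvature D X Y Z p \<bullet> W p)"

definition is_tanaka_webster :: "('m::finite cfield \<Rightarrow> 'm cfield \<Rightarrow> 'm cfield) \<Rightarrow> bool" where
  "is_tanaka_webster D \<longleftrightarrow>
    linear_connection D \<and>
    (\<forall>X\<in>vector_fields. \<forall>Y\<in>horizontal_fields. D X Y \<in> horizontal_fields) \<and>
    (\<forall>X\<in>vector_fields. \<forall>Y\<in>vector_fields. D X (cr_J Y) = cr_J (D X Y)) \<and>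
    (\<forall>X\<in>vector_fields. \<forall>Y\<in>vector_fields. \<forall>Z\<in>vector_fields. \<forall>p\<in>usphere.
      dir_deriv X (\<lambda>q. Y q \<bullet> Z q) p = D X Y p \<bullet> Z p + Y p \<bullet> D X Z p) \<and>
    (\<forall>X\<in>horizontal_fields. \<forall>Y\<in>horizontal_fields.
      torsion D X Y = (\<lambda>p. dtheta X Y p *\<^sub>R char_dir p)) \<and>
    (\<forall>Y\<in>vector_fields. torsion D char_dir Y = 0)"

text \<open>These properties determine the connection on \<^const>\<open>vector_fields\<close>; the choice below only
  concerns arguments that are not vector fields on the sphere.\<close>

definition tanaka_webster :: "'m::finite cfield \<Rightarrow> 'm cfield \<Rightarrow> 'm cfield" where
  "tanaka_webster = (SOME D. is_tanaka_webster D)"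

subsection \<open>The second variation form and its index\<close>

text \<open>The Riemannian volume of the unit sphere of a Euclidean space of dimension \<open>d\<close>: the volume
  of a Borel set \<open>A\<close> is \<open>d\<close> times the Lebesgue measure of \<open>{r x | 0 < r < 1, x \<in> A}\<close>, the
  normalisation given by integration in polar coordinates.\<close>

definition sphere_volume :: "'a::euclidean_space measure" where
  "sphere_volume =
    scale_measure (ennreal (real DIM('a)))
      (distr (restrict_space lborel (ball 0 1 - {0})) (restrict_space borel usphere) sgn)"

text \<open>The Levi distribution has rank \<open>2 n = 2 (CARD('m) - 1)\<close>. The second variation integrand at
  \<open>p\<close> is tensorial in the frame, so it only involves the values of the frame at \<open>p\<close>: it suffices
  that these form an orthonormal basis of the Levi distribution there. This allows the frame to
  consist of globally defined fields.\<close>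

definition horizontal_frame_at :: "complex ^ 'm::finite \<Rightarrow> (nat \<Rightarrow> 'm cfield) \<Rightarrow> bool" where
  "horizontal_frame_at p e \<longleftrightarrow>
    (\<forall>l\<in>{1..2 * (CARD('m) - 1)}. e l \<in> horizontal_fields) \<and>
    (\<forall>l\<in>{1..2 * (CARD('m) - 1)}. \<forall>k\<in>{1..2 * (CARD('m) - 1)}.
      e l p \<bullet> e k p = (if l = k then 1 else 0))"

definition second_variation_density :: "'m::finite cfield \<Rightarrow> complex ^ 'm \<Rightarrow> real" where
  "second_variation_density V p =
    (let e = (SOME e. horizontal_frame_at p e) in
      \<Sum>l = 1..2 * (CARD('m) - 1).
        tanaka_webster (e l) (hor V) p \<bullet> tanaka_webster (e l) (hor V) p
          - curvature4 tanaka_webster V (e l) V (e l) p)"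

definition second_variation :: "'m::finite cfield \<Rightarrow> real" where
  "second_variation V = (LINT p|sphere_volume. second_variation_density V p)"

text \<open>The supremum of the dimensions of the finite-dimensional spaces of vector fields on which
  the form is negative definite; an infinite-dimensional such space makes it infinite.\<close>

definition identity_index :: "'m::finite itself \<Rightarrow> enat" where
  "identity_index _ =
    Sup {enat (dim W) | W :: 'm cfield set.
      subspace W \<and> W \<subseteq> vector_fields \<and> (\<exists>B. finite B \<and> W = span B) \<and>
      (\<forall>V\<in>W. V \<noteq> 0 \<longrightarrow> second_variation V < 0)}"

end

theory Submission
  imports Defs "HOL-Combinatorics.Transposition"
begin

text \<open>
  The index is bounded below by exhibiting a negative definite space. For a constant vector \<open>a\<close>
  of \<open>\<complex>\<^bsup>n+1\<^esup>\<close> let \<open>V\<^sub>a\<close> be its horizontal projection, \<open>V\<^sub>a(p) = a - h p\<close>, where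
  \<open>h\<close> is the Hermitian product of \<open>a\<close> and \<open>p\<close> (\<open>test_field\<close>). These fields form a real vector space.
  If \<open>e\<close> is horizontal then the Tanaka-Webster derivative of \<open>V\<^sub>a\<close> along \<open>e\<close> is \<open>- h e\<close>, so the
  gradient term of the second variation is \<open>2 n |h|\<^sup>2\<close>. On the sphere the curvature has constant
  holomorphic sectional curvature 4 on the Levi distribution, so its trace on \<open>V\<^sub>a\<close> is
  \<open>(2 n + 2) |V\<^sub>a|\<^sup>2\<close>, and \<open>|V\<^sub>a|\<^sup>2 = |a|\<^sup>2 - |h|\<^sup>2\<close>. The mean of \<open>|h|\<^sup>2\<close> over the sphere is
  \<open>|a|\<^sup>2 / (n + 1)\<close>. The second variation of \<open>V\<^sub>a\<close> is therefore
  \<open>- 2 n\<^sup>2 |a|\<^sup>2 / (n + 1)\<close> times the volume, which is negative for \<open>a \<noteq> 0\<close> because \<open>n \<ge> 1\<close>. In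
  particular \<open>V\<^sub>a = 0\<close> only for \<open>a = 0\<close>, so the space has real dimension \<open>2 n + 2\<close>.

  The connection enters through a choice among all connections with the defining properties, so both
  existence and uniqueness are needed. Existence is an explicit formula in terms of the flat
  derivative (\<open>is_tanaka_webster_tw_connection\<close>), uniqueness on horizontal fields is the Koszul
  argument (\<open>is_tanaka_webster_unique\<close>). With the formula, the curvature applied to \<open>V\<^sub>a\<close> can be computed
  directly (\<open>curvature_test_field\<close>); the derivative of \<open>V\<^sub>a\<close> being explicit, second derivatives of
  general fields do not occur. The density follows with Parseval's identity
  (\<open>second_variation_density_test_field\<close>). The mean of \<open>|h|\<^sup>2\<close> comes from the invariance of Lebesgue
  measure under reflections and exchanges of coordinates (\<open>sphere_volume_second_moment\<close>).
\<close>

section \<open>Continuously differentiable functions\<close>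

lemma frechet_derivative_transform:
  assumes "open U" "x \<in> U" "\<And>y. y \<in> U \<Longrightarrow> f y = g y"
  shows "frechet_derivative f (at x) = frechet_derivative g (at x)"
proof -
  have "(f has_derivative D) (at x) \<longleftrightarrow> (g has_derivative D) (at x)" for D
    using has_derivative_transform_within_open[OF _ assms(1,2)] assms(3) by metis
  then show ?thesis by (simp add: frechet_derivative_def)
qed

text \<open>Smoothness is a recursive statement about \<open>frechet_derivative\<close>, which is a choice operator, so the
  closure properties below compute the derivative on the open set by a rule of calculus and then
  replace it there by the chosen one.\<close>

lemma ck_on_transform:
  assumes "open U" "\<And>x. x \<in> U \<Longrightarrow> f x = g x" "ck_on k U f"
  shows "ck_on k U g"
  using assms(2,3)
proof (induction k arbitrary: f g)
  case 0
  then show ?case using continuous_on_cong by force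
next
  case (Suc k)
  have "g differentiable_on U"
    using Suc.prems by (auto simp: differentiable_on_def
        intro: differentiable_transform_within[OF _ zero_less_one])
  moreover have "ck_on k U (\<lambda>x. frechet_derivative g (at x) v)" for v
  proof (rule Suc.IH)
    show "ck_on k U (\<lambda>x. frechet_derivative f (at x) v)"
      using Suc.prems(2) by simp
    show "frechet_derivative f (at x) v = frechet_derivative g (at x) v" if "x \<in> U" for x
      using fun_cong[OF frechet_derivative_transform[OF assms(1) that Suc.prems(1)]] .
  qed
  ultimately show ?case by simp
qed

lemma ck_on_subset:
  assumes "V \<subseteq> U" "ck_on k U f"
  shows "ck_on k V f"
  using assms(2)
  by (induction k arbitrary: f)
    (use assms(1) in \<open>auto intro: continuous_on_subset differentiable_on_subset\<close>)

lemma ck_on_Suc_imp: "ck_on (Suc k) U f \<Longrightarrow> ck_on k U f"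
  by (induction k arbitrary: f) (auto intro: differentiable_imp_continuous_on)

lemma ck_on_const: "ck_on k U (\<lambda>x. c)"
  by (induction k arbitrary: c) (auto simp: continuous_on_const)

lemma differentiable_on_open_at:
  "open U \<Longrightarrow> f differentiable_on U \<Longrightarrow> x \<in> U \<Longrightarrow> f differentiable (at x)"
  by (metis at_within_open differentiable_on_def)

lemma ck_on_add:
  assumes "open U" "ck_on k U f" "ck_on k U g"
  shows "ck_on k U (\<lambda>x. f x + g x)"
  using assms(2,3)
proof (induction k arbitrary: f g)
  case 0
  then show ?case by (simp add: continuous_on_add)
next
  case (Suc k)
  have D: "((\<lambda>x. f x + g x) has_derivative
      (\<lambda>v. frechet_derivative f (at x) v + frechet_derivative g (at x) v)) (at x)"
    if "x \<in> U" for x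
    using Suc.prems that assms(1)
    by (intro has_derivative_add)
      (auto simp: frechet_derivative_works[symmetric] intro: differentiable_on_open_at)
  have "ck_on k U (\<lambda>x. frechet_derivative (\<lambda>x. f x + g x) (at x) v)" for v
  proof (rule ck_on_transform[OF assms(1)])
    show "ck_on k U (\<lambda>x. frechet_derivative f (at x) v + frechet_derivative g (at x) v)"
      using Suc by simp
    show "frechet_derivative f (at x) v + frechet_derivative g (at x) v =
        frechet_derivative (\<lambda>x. f x + g x) (at x) v" if "x \<in> U" for x
      using fun_cong[OF frechet_derivative_at[OF D[OF that]]] .
  qed
  then show ?case using Suc.prems by (simp add: differentiable_on_add)
qed

lemma ck_on_linear:
  assumes "open U" "bounded_linear h" "ck_on k U f"
  shows "ck_on k U (\<lambda>x. h (f x))"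
  using assms(3)
proof (induction k arbitrary: f)
  case 0
  then show ?case 
    unfolding ck_on.simps by (rule bounded_linear.continuous_on[OF assms(2)])
next
  case (Suc k)
  have D: "((\<lambda>x. h (f x)) has_derivative (\<lambda>v. h (frechet_derivative f (at x) v))) (at x)"
    if "x \<in> U" for x
    using Suc.prems that assms(1)
    by (intro bounded_linear.has_derivative[OF assms(2)])
      (auto simp: frechet_derivative_works[symmetric] intro: differentiable_on_open_at)
  have "ck_on k U (\<lambda>x. frechet_derivative (\<lambda>x. h (f x)) (at x) v)" for v
  proof (rule ck_on_transform[OF assms(1)])
    show "ck_on k U (\<lambda>x. h (frechet_derivative f (at x) v))"
      using Suc by simp
    show "h (frechet_derivative f (at x) v) = frechet_derivative (\<lambda>x. h (f x)) (at x) v"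
      if "x \<in> U" for x
      using fun_cong[OF frechet_derivative_at[OF D[OF that]]] .
  qed
  moreover have "(\<lambda>x. h (f x)) differentiable_on U"
    using D unfolding differentiable_on_def differentiable_def
    by (blast intro: has_derivative_at_withinI)
  ultimately show ?case by simp
qed

lemma ck_on_bilinear:
  assumes "open U" "bounded_bilinear mul" "ck_on k U f" "ck_on k U g"
  shows "ck_on k U (\<lambda>x. mul (f x) (g x))"
  using assms(3,4)
proof (induction k arbitrary: f g)
  case 0
  then show ?case 
    unfolding ck_on.simps by (rule bounded_bilinear.continuous_on[OF assms(2)])
next
  case (Suc k)
  have D: "((\<lambda>x. mul (f x) (g x)) has_derivative (\<lambda>v. mul (f x) (frechet_derivative g (at x) v) +
      mul (frechet_derivative f (at x) v) (g x))) (at x)"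
    if "x \<in> U" for x
    using Suc.prems that assms(1)
    by (intro bounded_bilinear.FDERIV[OF assms(2)])
      (auto simp: frechet_derivative_works[symmetric] intro: differentiable_on_open_at)
  have "ck_on k U (\<lambda>x. frechet_derivative (\<lambda>x. mul (f x) (g x)) (at x) v)" for v
  proof (rule ck_on_transform[OF assms(1)])
    show "ck_on k U (\<lambda>x. mul (f x) (frechet_derivative g (at x) v) +
      mul (frechet_derivative f (at x) v) (g x))"
      using Suc.prems by (intro ck_on_add[OF assms(1)] Suc.IH) (auto intro: ck_on_Suc_imp)
    show "mul (f x) (frechet_derivative g (at x) v) +
      mul (frechet_derivative f (at x) v) (g x) = frechet_derivative (\<lambda>x. mul (f x) (g x)) (at x) v"
      if "x \<in> U" for x
      using fun_cong[OF frechet_derivative_at[OF D[OF that]]] .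
  qed
  moreover have "(\<lambda>x. mul (f x) (g x)) differentiable_on U"
    using D unfolding differentiable_on_def differentiable_def
    by (blast intro: has_derivative_at_withinI)
  ultimately show ?case by simp
qed

lemma ck_on_ident: "ck_on k U (\<lambda>x. x)"
  by (cases k) (auto simp: continuous_on_id differentiable_on_id ck_on_const)

lemma ck_on_sum:
  assumes "open U" "finite A" "\<And>i. i \<in> A \<Longrightarrow> ck_on k U (f i)"
  shows "ck_on k U (\<lambda>x. \<Sum>i\<in>A. f i x)"
  using assms(2,3) by (induction A) (auto intro: ck_on_add[OF assms(1)] ck_on_const)

section \<open>Smooth functions on the sphere\<close>

lemma smooth_on_sphereE:
  assumes "smooth_on_sphere f" "p \<in> usphere"
  obtains U F where "open U" "p \<in> U" "\<forall>k. ck_on k U F" "\<forall>x\<in>U \<inter> usphere. F x = f x"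
proof -
  obtain U F where "open U \<and> p \<in> U \<and> (\<forall>k. ck_on k U F) \<and> (\<forall>x\<in>U \<inter> usphere. F x = f x)"
    using bspec[OF assms(1)[unfolded smooth_on_sphere_def] assms(2)] by (elim exE)
  then show ?thesis by (intro that[of U F]) simp_all
qed

lemma smooth_on_sphere_global:
  assumes "\<And>k. ck_on k UNIV F" "\<And>x. x \<in> usphere \<Longrightarrow> F x = f x"
  shows "smooth_on_sphere f"
  unfolding smooth_on_sphere_def using assms
  by (intro ballI exI[of _ UNIV] exI[of _ F]) simp

lemma smooth_on_sphere_cong:
  assumes "\<And>x. x \<in> usphere \<Longrightarrow> f x = g x" 
  shows "smooth_on_sphere f \<longleftrightarrow> smooth_on_sphere g"
  unfolding smooth_on_sphere_def using assms by simp

lemma smooth_on_sphere_const: "smooth_on_sphere (\<lambda>x. c)"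
  by (rule smooth_on_sphere_global[OF ck_on_const]) simp

lemma smooth_on_sphere_ident: "smooth_on_sphere (\<lambda>x. x)"
  by (rule smooth_on_sphere_global[OF ck_on_ident]) simp

lemma smooth_on_sphere_linear:
  fixes f :: "'a::euclidean_space \<Rightarrow> 'b::real_normed_vector"
  assumes "bounded_linear h" "smooth_on_sphere f"
  shows "smooth_on_sphere (\<lambda>x. h (f x))"
  unfolding smooth_on_sphere_def
proof
  fix p :: 'a assume "p \<in> usphere"
  then obtain U F where "open U" "p \<in> U" "\<forall>k. ck_on k U F" "\<forall>x\<in>U \<inter> usphere. F x = f x"
    by (rule smooth_on_sphereE[OF assms(2)]) blast
  then show "\<exists>U F. open U \<and> p \<in> U \<and> (\<forall>k. ck_on k U F) \<and> (\<forall>x\<in>U \<inter> usphere. F x = h (f x))"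
    by (intro exI[of _ U] exI[of _ "\<lambda>x. h (F x)"]) (auto intro: ck_on_linear[OF _ assms(1)])
qed

text \<open>Two functions on the sphere extend to a common open set; this is what makes pointwise operations
  preserve smoothness.\<close>

lemma smooth_on_sphereE2:
  assumes "smooth_on_sphere f" "smooth_on_sphere g" "p \<in> usphere"
  obtains U F G where "open U" "p \<in> U" "\<forall>k. ck_on k U F" "\<forall>k. ck_on k U G"
    "\<forall>x\<in>U \<inter> usphere. F x = f x" "\<forall>x\<in>U \<inter> usphere. G x = g x"
proof -
  obtain U F where U: "open U" "p \<in> U" "\<forall>k. ck_on k U F" "\<forall>x\<in>U \<inter> usphere. F x = f x"
    by (rule smooth_on_sphereE[OF assms(1,3)]) blast
  obtain V G where V: "open V" "p \<in> V" "\<forall>k. ck_on k V G" "\<forall>x\<in>V \<inter> usphere. G x = g x"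
    by (rule smooth_on_sphereE[OF assms(2,3)]) blast
  show ?thesis
    using U V by (intro that[of "U \<inter> V" F G]) (auto intro: ck_on_subset)
qed

lemma smooth_on_sphere_bilinear:
  fixes f :: "'a::euclidean_space \<Rightarrow> 'b::real_normed_vector" and g :: "'a \<Rightarrow> 'c::real_normed_vector"
  assumes "bounded_bilinear mul" "smooth_on_sphere f" "smooth_on_sphere g"
  shows "smooth_on_sphere (\<lambda>x. mul (f x) (g x))"
  unfolding smooth_on_sphere_def
proof
  fix p :: 'a assume "p \<in> usphere"
  then obtain U F G where "open U" "p \<in> U" "\<forall>k. ck_on k U F" "\<forall>k. ck_on k U G"
    "\<forall>x\<in>U \<inter> usphere. F x = f x" "\<forall>x\<in>U \<inter> usphere. G x = g x"
    by (rule smooth_on_sphereE2[OF assms(2,3)]) blast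
  then show "\<exists>U F. open U \<and> p \<in> U \<and> (\<forall>k. ck_on k U F) \<and> (\<forall>x\<in>U \<inter> usphere. F x = mul (f x) (g x))"
    by (intro exI[of _ U] exI[of _ "\<lambda>x. mul (F x) (G x)"]) (auto intro: ck_on_bilinear[OF _ assms(1)])
qed

lemma smooth_on_sphere_add:
  fixes f g :: "'a::euclidean_space \<Rightarrow> 'b::real_normed_vector"
  assumes "smooth_on_sphere f" "smooth_on_sphere g"
  shows "smooth_on_sphere (\<lambda>x. f x + g x)"
  unfolding smooth_on_sphere_def
proof
  fix p :: 'a assume "p \<in> usphere"
  then obtain U F G where "open U" "p \<in> U" "\<forall>k. ck_on k U F" "\<forall>k. ck_on k U G"
    "\<forall>x\<in>U \<inter> usphere. F x = f x" "\<forall>x\<in>U \<inter> usphere. G x = g x"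
    by (rule smooth_on_sphereE2[OF assms]) blast
  then show "\<exists>U F. open U \<and> p \<in> U \<and> (\<forall>k. ck_on k U F) \<and> (\<forall>x\<in>U \<inter> usphere. F x = f x + g x)"
    by (intro exI[of _ U] exI[of _ "\<lambda>x. F x + G x"]) (auto intro: ck_on_add)
qed

lemma smooth_on_sphere_diff:
  fixes f g :: "'a::euclidean_space \<Rightarrow> 'b::real_normed_vector"
  assumes "smooth_on_sphere f" "smooth_on_sphere g"
  shows "smooth_on_sphere (\<lambda>x. f x - g x)"
  using smooth_on_sphere_add[OF assms(1) smooth_on_sphere_linear[OF bounded_linear_minus[OF bounded_linear_ident] assms(2)]]
  by simp

lemmas smooth_on_sphere_scaleR = smooth_on_sphere_bilinear[OF bounded_bilinear_scaleR]
lemmas smooth_on_sphere_inner = smooth_on_sphere_bilinear[OF bounded_bilinear_inner]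
lemmas smooth_on_sphere_mult = smooth_on_sphere_bilinear[OF bounded_bilinear_mult]

text \<open>The derivative of a local extension is a derivative within the sphere. Derivatives within the sphere
  are thus available for every smooth function, although they are not unique as linear maps on the
  ambient space.\<close>

lemma smooth_on_sphere_has_derivative_extension:
  assumes "open U" "p \<in> U" "p \<in> usphere" "ck_on (Suc 0) U F" "\<And>x. x \<in> U \<Longrightarrow> x \<in> usphere \<Longrightarrow> F x = f x"
  shows "(f has_derivative frechet_derivative F (at p)) (at p within usphere)"
proof -
  have "(F has_derivative frechet_derivative F (at p)) (at p)"
    using assms by (auto simp: frechet_derivative_works[symmetric] intro: differentiable_on_open_at)
  then have "(F has_derivative frechet_derivative F (at p)) (at p within usphere)"
    by (rule has_derivative_at_withinI)
  moreover have "eventually (\<lambda>x. x \<in> U) (at p within usphere)"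
    using assms(1,2) eventually_at_topological by blast
  then have "eventually (\<lambda>x. F x = f x) (at p within usphere)"
    using assms(5) by (auto simp: eventually_at_filter elim!: eventually_mono)
  ultimately show ?thesis
    using has_derivative_transform_eventually[of F _ p "usphere" f] assms by auto
qed

lemma smooth_on_sphere_has_derivative:
  assumes "smooth_on_sphere f" "p \<in> usphere"
  shows "(f has_derivative frechet_derivative f (at p within usphere)) (at p within usphere)"
proof -
  obtain U F where "open U" "p \<in> U" "\<forall>k. ck_on k U F" "\<forall>x\<in>U \<inter> usphere. F x = f x"
    using smooth_on_sphereE[OF assms] by blast
  then have "(f has_derivative frechet_derivative F (at p)) (at p within usphere)"
    using assms(2) smooth_on_sphere_has_derivative_extension[of U p F f] by blast
  then show ?thesis
    by (metis differentiableI frechet_derivative_works)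
qed

text \<open>A function on the sphere restricts to the great circle through \<open>p\<close> in a tangent direction, and
  the derivative of this restriction is the value there of any derivative within the sphere.\<close>

lemma sphere_derivative_unique:
  fixes p v :: "'a::euclidean_space"
  assumes "p \<in> usphere" "v \<bullet> p = 0"
    and "(f has_derivative f1) (at p within usphere)" "(f has_derivative f2) (at p within usphere)"
  shows "f1 v = f2 v"
proof (cases "v = 0")
  case True
  then show ?thesis
    using assms(3,4) by (metis has_derivative_linear linear_0)
next
  case False
  define u where "u = sgn v"
  have u: "norm u = 1" "u \<bullet> p = 0" "v = norm v *\<^sub>R u"
    using False assms(2) by (auto simp: u_def norm_sgn sgn_div_norm)
  define c where "c t = cos t *\<^sub>R p + sin t *\<^sub>R u" for t
  have "c t \<in> usphere" for t
  proof -
    have "u \<bullet> u = 1" "p \<bullet> p = 1" using u(1) assms(1) by (auto simp: dot_square_norm)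
    then have "c t \<bullet> c t = (cos t)\<^sup>2 + (sin t)\<^sup>2"
      using u(2) by (simp add: c_def inner_add_left inner_add_right inner_commute[of p u] power2_eq_square)
    then show ?thesis by (simp add: norm_eq_sqrt_inner)
  qed
  then have c: "range c \<subseteq> usphere" by blast
  have dc: "(c has_derivative (\<lambda>t. t *\<^sub>R u)) (at 0)"
    unfolding c_def by (auto intro!: derivative_eq_intros)
  have c0: "c 0 = p" by (simp add: c_def)
  have *: "((\<lambda>t. f (c t)) has_derivative (\<lambda>t. D (t *\<^sub>R u))) (at 0)"
    if "(f has_derivative D) (at p within usphere)" for D
    using has_derivative_in_compose[OF dc, of f D] has_derivative_subset[OF that c] c0 by auto
  have "(\<lambda>t. f1 (t *\<^sub>R u)) = (\<lambda>t. f2 (t *\<^sub>R u))"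
    by (rule has_derivative_unique[OF *[OF assms(3)] *[OF assms(4)]])
  then show ?thesis using u(3) by metis
qed

text \<open>All computations with \<open>dir_deriv\<close> go through this rule: the derivative along a tangent field may be
  read off from any derivative within the sphere, however it was obtained.\<close>

lemma dir_deriv_eqI:
  assumes "p \<in> usphere" "X p \<bullet> p = 0" "(f has_derivative f') (at p within usphere)"
  shows "dir_deriv X f p = f' (X p)"
proof -
  have "(f has_derivative frechet_derivative f (at p within usphere)) (at p within usphere)"
    using assms(3) by (metis differentiableI frechet_derivative_works)
  then show ?thesis
    using sphere_derivative_unique[OF assms(1,2) _ assms(3)] assms(1)
    by (simp add: dir_deriv_def)
qed

lemma dir_deriv_outside: "p \<notin> usphere \<Longrightarrow> dir_deriv X f p = 0"
  by (simp add: dir_deriv_def)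

lemma dir_deriv_cong:
  assumes "\<And>q. q \<in> usphere \<Longrightarrow> f q = g q"
  shows "dir_deriv X f p = dir_deriv X g p"
proof (cases "p \<in> usphere")
  case True
  have "(f has_derivative D) (at p within usphere) \<longleftrightarrow> (g has_derivative D) (at p within usphere)" for D
    using has_derivative_transform[of p usphere g f D] has_derivative_transform[of p usphere f g D]
      assms True by auto
  then show ?thesis by (simp add: frechet_derivative_def dir_deriv_def)
qed (simp add: dir_deriv_def)

section \<open>Derivatives along tangent fields\<close>

lemma dir_deriv_eq_frechet:
  "p \<in> usphere \<Longrightarrow> dir_deriv X f p = frechet_derivative f (at p within usphere) (X p)"
  by (simp add: dir_deriv_def)

lemma dir_deriv_const:
  assumes "p \<in> usphere" "X p \<bullet> p = 0"
  shows "dir_deriv X (\<lambda>x. c) p = 0"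
  using dir_deriv_eqI[of p X "\<lambda>x. c" "\<lambda>h. 0"] assms by simp

lemma dir_deriv_ident:
  assumes "p \<in> usphere" "X p \<bullet> p = 0"
  shows "dir_deriv X (\<lambda>x. x) p = X p"
  using dir_deriv_eqI[of p X "\<lambda>x. x" "\<lambda>h. h"] assms by simp

lemma dir_deriv_linear:
  assumes "p \<in> usphere" "X p \<bullet> p = 0" "bounded_linear h" "smooth_on_sphere f"
  shows "dir_deriv X (\<lambda>x. h (f x)) p = h (dir_deriv X f p)"
proof -
  have "((\<lambda>x. h (f x)) has_derivative (\<lambda>v. h (frechet_derivative f (at p within usphere) v))) (at p within usphere)"
    using assms by (intro bounded_linear.has_derivative[OF assms(3)] smooth_on_sphere_has_derivative)
  from dir_deriv_eqI[of p X "(\<lambda>x. h (f x))", OF assms(1,2) this] show ?thesis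
    by (simp add: dir_deriv_eq_frechet[OF assms(1)])
qed

lemma dir_deriv_add:
  assumes "p \<in> usphere" "X p \<bullet> p = 0" "smooth_on_sphere f" "smooth_on_sphere g"
  shows "dir_deriv X (\<lambda>x. f x + g x) p = dir_deriv X f p + dir_deriv X g p"
proof -
  have "((\<lambda>x. f x + g x) has_derivative (\<lambda>v. frechet_derivative f (at p within usphere) v + frechet_derivative g (at p within usphere) v)) (at p within usphere)"
    using assms by (intro has_derivative_add smooth_on_sphere_has_derivative)
  from dir_deriv_eqI[of p X "(\<lambda>x. f x + g x)", OF assms(1,2) this] show ?thesis
    by (simp add: dir_deriv_eq_frechet[OF assms(1)])
qed

lemma dir_deriv_bilinear:
  assumes "bounded_bilinear mul" "p \<in> usphere" "X p \<bullet> p = 0" "smooth_on_sphere f" "smooth_on_sphere g"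
  shows "dir_deriv X (\<lambda>x. mul (f x) (g x)) p = mul (f p) (dir_deriv X g p) + mul (dir_deriv X f p) (g p)"
proof -
  have "((\<lambda>x. mul (f x) (g x)) has_derivative (\<lambda>v. mul (f p) (frechet_derivative g (at p within usphere) v) + mul (frechet_derivative f (at p within usphere) v) (g p))) (at p within usphere)"
    using assms by (intro bounded_bilinear.FDERIV[OF assms(1)] smooth_on_sphere_has_derivative)
  from dir_deriv_eqI[of p X "(\<lambda>x. mul (f x) (g x))", OF assms(2,3) this] show ?thesis
    by (simp add: dir_deriv_eq_frechet[OF assms(2)])
qed

lemmas dir_deriv_scaleR = dir_deriv_bilinear[OF bounded_bilinear_scaleR]
lemmas dir_deriv_inner = dir_deriv_bilinear[OF bounded_bilinear_inner]

lemma dir_deriv_field_add: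
  assumes "smooth_on_sphere f"
  shows "dir_deriv (X + Y) f p = dir_deriv X f p + dir_deriv Y f p"
  using linear_add[OF has_derivative_linear[OF smooth_on_sphere_has_derivative[OF assms]]]
  by (simp add: dir_deriv_def)

lemma dir_deriv_field_scaleR:
  assumes "smooth_on_sphere f"
  shows "dir_deriv (\<lambda>p. g p *\<^sub>R X p) f p = g p *\<^sub>R dir_deriv X f p"
  using linear_cmul[OF has_derivative_linear[OF smooth_on_sphere_has_derivative[OF assms]]]
  by (simp add: dir_deriv_def)

lemma vector_fieldsD:
  assumes "V \<in> vector_fields"
  shows "smooth_on_sphere V" "p \<in> usphere \<Longrightarrow> V p \<bullet> p = 0" "p \<notin> usphere \<Longrightarrow> V p = 0"
  using assms by (auto simp: vector_fields_def)

text \<open>For local extensions \<open>F\<close> of the function and \<open>G\<close> of the field, the derivative is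
  \<open>F' x (G x) = (\<Sum>b\<in>Basis. (G x \<bullet> b) F' x b)\<close>. Expanding in a basis separates the point from the
  direction, and each summand is a product of functions that are known to be smooth.\<close>

lemma smooth_on_sphere_dir_deriv:
  assumes X: "X \<in> vector_fields" and f: "smooth_on_sphere f"
  shows "smooth_on_sphere (dir_deriv X f)"
  unfolding smooth_on_sphere_def
proof
  fix p :: "complex ^ 'a" assume p: "p \<in> usphere"
  obtain U F G where U: "open U" "p \<in> U" "\<forall>k. ck_on k U F" "\<forall>k. ck_on k U G"
    "\<forall>x\<in>U \<inter> usphere. F x = f x" "\<forall>x\<in>U \<inter> usphere. G x = X x"
    by (rule smooth_on_sphereE2[OF f vector_fieldsD(1)[OF X] p]) blast
  define H where "H x = (\<Sum>b\<in>Basis. (G x \<bullet> b) *\<^sub>R frechet_derivative F (at x) b)" for x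
  have "ck_on k U H" for k
  proof -
    have "ck_on (Suc k) U F" using U(3) by blast
    then have "ck_on k U (\<lambda>x. frechet_derivative F (at x) b)" for b by simp
    moreover have "ck_on k U (\<lambda>x. G x \<bullet> b)" for b
      using ck_on_linear[OF U(1) bounded_linear_inner_left] U(4) by blast
    ultimately show ?thesis unfolding H_def
      by (intro ck_on_sum U(1) ck_on_bilinear[OF U(1) bounded_bilinear_scaleR]) auto
  qed
  moreover have "H x = dir_deriv X f x" if x: "x \<in> U \<inter> usphere" for x
  proof -
    have "ck_on (Suc 0) U F" using U(3) by blast
    then have D: "(f has_derivative frechet_derivative F (at x)) (at x within usphere)"
      using smooth_on_sphere_has_derivative_extension[of U x F f] U x by blast
    then have lin: "linear (frechet_derivative F (at x))" by (rule has_derivative_linear)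
    have "dir_deriv X f x = frechet_derivative F (at x) (X x)"
      using dir_deriv_eqI[OF _ _ D] x vector_fieldsD(2)[OF X] by blast
    also have "\<dots> = frechet_derivative F (at x) (\<Sum>b\<in>Basis. (G x \<bullet> b) *\<^sub>R b)"
      using U(6) x by (simp add: euclidean_representation)
    also have "\<dots> = H x"
      unfolding H_def by (simp add: linear_sum[OF lin] linear_cmul[OF lin])
    finally show ?thesis by simp
  qed
  ultimately show "\<exists>U F. open U \<and> p \<in> U \<and> (\<forall>k. ck_on k U F) \<and> (\<forall>x\<in>U \<inter> usphere. F x = dir_deriv X f x)"
    using U(1,2) by blast
qed

section \<open>The complex structure and the characteristic direction\<close>

lemma bounded_linear_mult_i: "bounded_linear mult_i"
proof -
  have "linear mult_i"
    by (rule linearI) (simp_all add: mult_i_def vec_eq_iff algebra_simps scaleR_conv_of_real)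
  then show ?thesis by (simp add: linear_conv_bounded_linear)
qed

lemmas mult_i_linear_simps =
  linear_add[OF bounded_linear.linear[OF bounded_linear_mult_i]]
  linear_diff[OF bounded_linear.linear[OF bounded_linear_mult_i]]
  linear_cmul[OF bounded_linear.linear[OF bounded_linear_mult_i]]
  linear_neg[OF bounded_linear.linear[OF bounded_linear_mult_i]]

lemma mult_i_zero [simp]: "mult_i 0 = 0"
  using linear_0[OF bounded_linear.linear[OF bounded_linear_mult_i]] .

lemma mult_i_mult_i [simp]: "mult_i (mult_i v) = - v"
  by (simp add: mult_i_def vec_eq_iff mult.assoc[symmetric])

lemma inner_mult_i_mult_i: "mult_i u \<bullet> mult_i v = u \<bullet> v"
  by (simp add: mult_i_def inner_vec_def inner_complex_def add.commute)

lemma inner_mult_i_left: "mult_i u \<bullet> v = - (u \<bullet> mult_i v)"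
  using inner_mult_i_mult_i[of u "mult_i v"] by simp

lemma inner_mult_i_swap: "u \<bullet> mult_i v = - (v \<bullet> mult_i u)"
  by (metis inner_commute inner_mult_i_left)

lemma inner_mult_i_self [simp]: "u \<bullet> mult_i u = 0" "mult_i u \<bullet> u = 0"
  using inner_mult_i_swap[of u u] by (simp_all add: inner_mult_i_left)

lemma char_dir_on [simp]: "p \<in> usphere \<Longrightarrow> char_dir p = mult_i p"
  and char_dir_off [simp]: "p \<notin> usphere \<Longrightarrow> char_dir p = 0"
  by (auto simp: char_dir_def)

lemmas smooth_intros = smooth_on_sphere_add smooth_on_sphere_diff smooth_on_sphere_scaleR
  smooth_on_sphere_inner smooth_on_sphere_mult smooth_on_sphere_const smooth_on_sphere_ident
  smooth_on_sphere_linear[OF bounded_linear_mult_i] smooth_on_sphere_dir_deriv vector_fieldsD(1)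

lemma horizontal_fieldsD:
  assumes "V \<in> horizontal_fields"
  shows "V \<in> vector_fields" "p \<in> usphere \<Longrightarrow> V p \<bullet> mult_i p = 0"
  using assms by (auto simp: horizontal_fields_def inner_mult_i_left)

lemma horizontal_fieldsI:
  assumes "V \<in> vector_fields" "\<And>p. p \<in> usphere \<Longrightarrow> V p \<bullet> mult_i p = 0"
  shows "V \<in> horizontal_fields"
  using assms by (auto simp: horizontal_fields_def inner_mult_i_left)

lemma char_dir_vector_field: "char_dir \<in> vector_fields"
proof -
  have "smooth_on_sphere (char_dir :: complex ^ 'm \<Rightarrow> _)"
    using smooth_on_sphere_cong[of char_dir "mult_i :: complex ^ 'm \<Rightarrow> _"]
      smooth_on_sphere_linear[OF bounded_linear_mult_i smooth_on_sphere_ident] by simp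
  then show ?thesis by (simp add: vector_fields_def)
qed

lemma vector_fields_diff:
  "X \<in> vector_fields \<Longrightarrow> Y \<in> vector_fields \<Longrightarrow> X - Y \<in> vector_fields"
  by (auto simp: vector_fields_def inner_diff_left fun_diff_def intro: smooth_on_sphere_diff)

lemma vector_fields_scale:
  "smooth_on_sphere f \<Longrightarrow> X \<in> vector_fields \<Longrightarrow> (\<lambda>p. f p *\<^sub>R X p) \<in> vector_fields"
  by (auto simp: vector_fields_def intro: smooth_on_sphere_scaleR)

text \<open>Differentiate \<open>Y q \<bullet> q = 0\<close>: this is the second fundamental form of the sphere.\<close>

lemma dir_deriv_tangent:
  assumes "X \<in> vector_fields" "Y \<in> vector_fields" "p \<in> usphere"
  shows "dir_deriv X Y p \<bullet> p = - (X p \<bullet> Y p)"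
proof -
  note t = vector_fieldsD(2)[OF assms(1,3)]
  have "dir_deriv X (\<lambda>q. Y q \<bullet> q) p = dir_deriv X (\<lambda>q. 0::real) p"
    by (rule dir_deriv_cong) (rule vector_fieldsD(2)[OF assms(2)])
  also have "\<dots> = 0" by (rule dir_deriv_const[where p=p and X=X, OF assms(3) t])
  finally show ?thesis
    using dir_deriv_inner[where p=p and X=X, OF assms(3) t vector_fieldsD(1)[OF assms(2)] smooth_on_sphere_ident]
      dir_deriv_ident[where p=p and X=X, OF assms(3) t] by (simp add: inner_commute)
qed

lemma dir_deriv_theta:
  assumes "X \<in> vector_fields" "Y \<in> vector_fields" "p \<in> usphere"
  shows "dir_deriv X (theta Y) p = dir_deriv X Y p \<bullet> mult_i p + Y p \<bullet> mult_i (X p)"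
proof -
  note t = vector_fieldsD(2)[OF assms(1,3)]
  have "dir_deriv X (theta Y) p = dir_deriv X (\<lambda>q. Y q \<bullet> mult_i q) p"
    by (rule dir_deriv_cong) (simp add: theta_def)
  also have "\<dots> = Y p \<bullet> dir_deriv X mult_i p + dir_deriv X Y p \<bullet> mult_i p"
    using assms t by (intro dir_deriv_inner[where p=p and X=X] vector_fieldsD(1)
        smooth_on_sphere_linear[OF bounded_linear_mult_i smooth_on_sphere_ident])
  also have "dir_deriv X mult_i p = mult_i (X p)"
    using dir_deriv_linear[where p=p and X=X, OF assms(3) t bounded_linear_mult_i smooth_on_sphere_ident]
      dir_deriv_ident[where p=p and X=X, OF assms(3) t] by simp
  finally show ?thesis by simp
qed

text \<open>Differentiate \<open>Y q \<bullet> mult_i q = 0\<close>: the analogue of the second fundamental form for the Levi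
  distribution. It determines \<open>dtheta\<close> on horizontal fields.\<close>

lemma dir_deriv_horizontal:
  assumes "X \<in> vector_fields" "Y \<in> horizontal_fields" "p \<in> usphere"
  shows "dir_deriv X Y p \<bullet> mult_i p = - (Y p \<bullet> mult_i (X p))"
proof -
  have "dir_deriv X (theta Y) p = dir_deriv X (\<lambda>q. 0::real) p"
    by (rule dir_deriv_cong) (simp add: theta_def horizontal_fieldsD(2)[OF assms(2)])
  then show ?thesis
    using dir_deriv_const[where p=p and X=X and c="0::real", OF assms(3) vector_fieldsD(2)[OF assms(1,3)]]
      dir_deriv_theta[OF assms(1) horizontal_fieldsD(1)[OF assms(2)] assms(3)] by simp
qed

lemma lie_bracket_vector_field:
  assumes "X \<in> vector_fields" "Y \<in> vector_fields"
  shows "lie_bracket X Y \<in> vector_fields"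
proof -
  have "smooth_on_sphere (lie_bracket X Y)"
    unfolding lie_bracket_def fun_diff_def using assms by (intro smooth_intros)
  then show ?thesis
    using assms dir_deriv_tangent[OF assms] dir_deriv_tangent[OF assms(2,1)]
    by (auto simp: vector_fields_def lie_bracket_def inner_diff_left inner_commute[of "X _"]
        dir_deriv_outside simp del: mem_sphere)
qed

lemma hor_on: "p \<in> usphere \<Longrightarrow> hor V p = V p - (V p \<bullet> mult_i p) *\<^sub>R mult_i p"
  and hor_off: "p \<notin> usphere \<Longrightarrow> hor V p = V p"
  by (simp_all add: hor_def)

lemma hor_horizontal_field:
  assumes "V \<in> vector_fields"
  shows "hor V \<in> horizontal_fields"
proof (rule horizontal_fieldsI)
  have "smooth_on_sphere (hor V)"
    unfolding hor_def using assms char_dir_vector_field by (intro smooth_intros)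
  then show "hor V \<in> vector_fields"
    using assms by (auto simp: vector_fields_def hor_on hor_off inner_diff_left simp del: mem_sphere)
  show "hor V p \<bullet> mult_i p = 0" if "p \<in> usphere" for p
    using that by (simp add: hor_on inner_diff_left inner_mult_i_mult_i norm_eq_1)
qed

lemma hor_horizontal: "V \<in> horizontal_fields \<Longrightarrow> hor V = V"
  by (rule ext) (metis (no_types) diff_zero hor_off hor_on horizontal_fieldsD(2) scale_zero_left)

lemma cr_J_on: "p \<in> usphere \<Longrightarrow> cr_J V p = mult_i (V p) + (V p \<bullet> mult_i p) *\<^sub>R p"
  and cr_J_off: "p \<notin> usphere \<Longrightarrow> cr_J V p = mult_i (V p)"
  by (simp_all add: cr_J_def hor_on hor_off mult_i_linear_simps)

lemma cr_J_vector_field: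
  assumes "V \<in> vector_fields"
  shows "cr_J V \<in> vector_fields"
proof -
  have "smooth_on_sphere (cr_J V)"
    unfolding cr_J_def using horizontal_fieldsD(1)[OF hor_horizontal_field[OF assms]]
    by (intro smooth_intros)
  then show ?thesis
    using assms by (auto simp: vector_fields_def cr_J_on cr_J_off inner_add_left
        norm_eq_1 inner_mult_i_left simp del: mem_sphere)
qed

section \<open>The Tanaka-Webster connection\<close>

text \<open>For horizontal \<open>Y\<close> the connection is the projection of \<open>dir_deriv X Y\<close> to the Levi distribution,
  corrected in the characteristic direction by \<open>- theta X\<close> times \<open>mult_i Y\<close>, because
  vanishing torsion forces the derivative along \<open>char_dir\<close> to be the Lie bracket; the
  characteristic direction itself is parallel. Expanding \<open>Y = hor Y + theta Y char_dir\<close> in these rules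
  and evaluating the normal components gives the formula below. In this form the connection is visibly
  the flat derivative plus a term bilinear in the values of \<open>X\<close> and \<open>Y\<close> at \<open>p\<close>, so the axioms of a
  linear connection are those of \<open>dir_deriv\<close>.\<close>

definition tw_connection :: "'m::finite cfield \<Rightarrow> 'm cfield \<Rightarrow> 'm cfield" where
  "tw_connection X Y p =
    dir_deriv X Y p - (Y p \<bullet> mult_i p) *\<^sub>R mult_i (X p) - (X p \<bullet> mult_i p) *\<^sub>R mult_i (Y p)
    + (X p \<bullet> Y p - 2 * (X p \<bullet> mult_i p) * (Y p \<bullet> mult_i p)) *\<^sub>R p
    + (Y p \<bullet> mult_i (X p)) *\<^sub>R mult_i p"

lemma tw_connection_off:
  "X \<in> vector_fields \<Longrightarrow> Y \<in> vector_fields \<Longrightarrow> p \<notin> usphere \<Longrightarrow> tw_connection X Y p = 0"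
  by (simp add: tw_connection_def dir_deriv_outside vector_fieldsD(3) del: mem_sphere)

lemma tw_connection_vector_field:
  assumes "X \<in> vector_fields" "Y \<in> vector_fields"
  shows "tw_connection X Y \<in> vector_fields"
proof -
  have "smooth_on_sphere (tw_connection X Y)"
    unfolding tw_connection_def using assms by (intro smooth_intros)
  moreover have "tw_connection X Y p \<bullet> p = 0" if p: "p \<in> usphere" for p
    using p assms
    by (simp add: tw_connection_def inner_add_left inner_diff_left dir_deriv_tangent[OF assms p]
        inner_mult_i_left norm_eq_1 algebra_simps del: mem_sphere)
  ultimately show ?thesis
    using tw_connection_off[OF assms] by (auto simp: vector_fields_def)
qed

lemma linear_connection_tw: "linear_connection tw_connection"
  unfolding linear_connection_def
proof (intro conjI ballI allI impI)
  fix X Y :: "'a cfield" assume X: "X \<in> vector_fields" and Y: "Y \<in> vector_fields"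
  show "tw_connection X Y \<in> vector_fields" using X Y by (rule tw_connection_vector_field)
  fix Z :: "'a cfield" assume Z: "Z \<in> vector_fields"
  show "tw_connection (X + Y) Z = tw_connection X Z + tw_connection Y Z"
    by (rule ext) (simp add: tw_connection_def dir_deriv_field_add[OF vector_fieldsD(1)[OF Z]]
        inner_add_left inner_add_right mult_i_linear_simps algebra_simps)
  show "tw_connection X (Y + Z) = tw_connection X Y + tw_connection X Z"
  proof
    fix p
    have "dir_deriv X (Y + Z) p = dir_deriv X Y p + dir_deriv X Z p"
    proof (cases "p \<in> usphere")
      case True
      show ?thesis unfolding plus_fun_def
        by (rule dir_deriv_add[where X=X, OF True vector_fieldsD(2)[OF X True]
              vector_fieldsD(1)[OF Y] vector_fieldsD(1)[OF Z]])
    qed (simp add: dir_deriv_outside del: mem_sphere)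
    then show "tw_connection X (Y + Z) p = (tw_connection X Y + tw_connection X Z) p"
      by (simp add: tw_connection_def inner_add_left inner_add_right mult_i_linear_simps algebra_simps)
  qed
next
  fix f :: "complex ^ 'a \<Rightarrow> real" and X Y :: "'a cfield"
  assume f: "smooth_on_sphere f" and X: "X \<in> vector_fields" and Y: "Y \<in> vector_fields"
  show "tw_connection (\<lambda>p. f p *\<^sub>R X p) Y = (\<lambda>p. f p *\<^sub>R tw_connection X Y p)"
    by (rule ext) (simp add: tw_connection_def dir_deriv_field_scaleR[OF vector_fieldsD(1)[OF Y]]
        mult_i_linear_simps algebra_simps)
  show "tw_connection X (\<lambda>p. f p *\<^sub>R Y p) = (\<lambda>p. dir_deriv X f p *\<^sub>R Y p + f p *\<^sub>R tw_connection X Y p)"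
  proof
    fix p
    have "dir_deriv X (\<lambda>p. f p *\<^sub>R Y p) p = f p *\<^sub>R dir_deriv X Y p + dir_deriv X f p *\<^sub>R Y p"
    proof (cases "p \<in> usphere")
      case True
      show ?thesis
        by (rule dir_deriv_scaleR[where X=X, OF True vector_fieldsD(2)[OF X True] f
              vector_fieldsD(1)[OF Y]])
    qed (simp add: dir_deriv_outside del: mem_sphere)
    then show "tw_connection X (\<lambda>p. f p *\<^sub>R Y p) p = dir_deriv X f p *\<^sub>R Y p + f p *\<^sub>R tw_connection X Y p"
      by (simp add: tw_connection_def mult_i_linear_simps algebra_simps)
  qed
qed

lemma tw_connection_horizontal:
  assumes "X \<in> vector_fields" "Y \<in> horizontal_fields"
  shows "tw_connection X Y \<in> horizontal_fields"
proof (rule horizontal_fieldsI)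
  note Y = horizontal_fieldsD(1)[OF assms(2)]
  show "tw_connection X Y \<in> vector_fields" by (rule tw_connection_vector_field[OF assms(1) Y])
  show "tw_connection X Y p \<bullet> mult_i p = 0" if p: "p \<in> usphere" for p
    using p horizontal_fieldsD(2)[OF assms(2) p] vector_fieldsD(2)[OF assms(1) p] vector_fieldsD(2)[OF Y p]
    by (simp add: tw_connection_def inner_add_left inner_diff_left inner_mult_i_mult_i
        dir_deriv_horizontal[OF assms p] norm_eq_1 del: mem_sphere)
qed

lemma tw_connection_cr_J:
  assumes X: "X \<in> vector_fields" and Y: "Y \<in> vector_fields"
  shows "tw_connection X (cr_J Y) = cr_J (tw_connection X Y)"
proof
  fix p
  show "tw_connection X (cr_J Y) p = cr_J (tw_connection X Y) p"
  proof (cases "p \<in> usphere")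
    case p: True
    note tX = vector_fieldsD(2)[OF X p] and sY = vector_fieldsD(1)[OF Y]
    have s1: "smooth_on_sphere (\<lambda>q. mult_i (Y q))"
      and s2: "smooth_on_sphere (\<lambda>q. Y q \<bullet> mult_i q)"
      and s3: "smooth_on_sphere (\<lambda>q. (Y q \<bullet> mult_i q) *\<^sub>R q)"
      using Y by (intro smooth_intros; assumption)+
    have "dir_deriv X (\<lambda>q. Y q \<bullet> mult_i q) p = dir_deriv X (theta Y) p"
      by (rule dir_deriv_cong) (simp add: theta_def)
    then have th: "dir_deriv X (\<lambda>q. Y q \<bullet> mult_i q) p =
        dir_deriv X Y p \<bullet> mult_i p + Y p \<bullet> mult_i (X p)"
      using dir_deriv_theta[OF X Y p] by simp
    have "dir_deriv X (cr_J Y) p = dir_deriv X (\<lambda>q. mult_i (Y q) + (Y q \<bullet> mult_i q) *\<^sub>R q) p"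
      by (rule dir_deriv_cong) (rule cr_J_on)
    also have "\<dots> = dir_deriv X (\<lambda>q. mult_i (Y q)) p + dir_deriv X (\<lambda>q. (Y q \<bullet> mult_i q) *\<^sub>R q) p"
      by (rule dir_deriv_add[where X=X, OF p tX s1 s3])
    also have "dir_deriv X (\<lambda>q. mult_i (Y q)) p = mult_i (dir_deriv X Y p)"
      by (rule dir_deriv_linear[where X=X, OF p tX bounded_linear_mult_i sY])
    also have "dir_deriv X (\<lambda>q. (Y q \<bullet> mult_i q) *\<^sub>R q) p =
        (Y p \<bullet> mult_i p) *\<^sub>R X p + (dir_deriv X Y p \<bullet> mult_i p + Y p \<bullet> mult_i (X p)) *\<^sub>R p"
      using dir_deriv_scaleR[where X=X, OF p tX s2 smooth_on_sphere_ident]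
        dir_deriv_ident[where X=X, OF p tX] th by simp
    finally have d: "dir_deriv X (cr_J Y) p = mult_i (dir_deriv X Y p) + ((Y p \<bullet> mult_i p) *\<^sub>R X p
        + (dir_deriv X Y p \<bullet> mult_i p + Y p \<bullet> mult_i (X p)) *\<^sub>R p)" .
    have f: "p \<bullet> p = 1" "X p \<bullet> p = 0" "Y p \<bullet> p = 0" "p \<bullet> X p = 0" "p \<bullet> Y p = 0"
      "p \<bullet> mult_i (X p) = - (X p \<bullet> mult_i p)" "p \<bullet> mult_i (Y p) = - (Y p \<bullet> mult_i p)"
      "X p \<bullet> mult_i (Y p) = - (Y p \<bullet> mult_i (X p))" "Y p \<bullet> X p = X p \<bullet> Y p"
      "p \<bullet> mult_i p = 0"
      using p tX vector_fieldsD(2)[OF Y p] 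
      by (simp_all add: norm_eq_1 inner_commute[of p "X p"] inner_commute[of p "Y p"]
          inner_mult_i_swap[of p "X p"] inner_mult_i_swap[of p "Y p"] inner_mult_i_swap[of "X p" "Y p"]
          inner_commute[of "Y p" "X p"] del: mem_sphere)
    show ?thesis
      unfolding tw_connection_def cr_J_on[OF p] d
      by (simp add: f inner_add_left inner_add_right inner_diff_left inner_diff_right
          mult_i_linear_simps inner_mult_i_mult_i inner_mult_i_left algebra_simps)
        (simp only: mult_2 mult_2_right scaleR_add_left scaleR_add_right)
  next
    case p: False
    then show ?thesis
      using tw_connection_off[OF X cr_J_vector_field[OF Y] p] tw_connection_off[OF X Y p]
      by (simp add: cr_J_off)
  qed
qed

text \<open>The correction terms are skew-symmetric in \<open>Y\<close> and \<open>Z\<close> on tangent vectors, so they cancel against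
  the product rule for the flat derivative.\<close>

lemma tw_connection_metric:
  assumes X: "X \<in> vector_fields" and Y: "Y \<in> vector_fields" and Z: "Z \<in> vector_fields"
    and p: "p \<in> usphere"
  shows "dir_deriv X (\<lambda>q. Y q \<bullet> Z q) p = tw_connection X Y p \<bullet> Z p + Y p \<bullet> tw_connection X Z p"
proof -
  have f: "p \<bullet> Y p = 0" "p \<bullet> Z p = 0" "Y p \<bullet> p = 0" "Z p \<bullet> p = 0"
      "Z p \<bullet> mult_i (Y p) = - (Y p \<bullet> mult_i (Z p))"
      "X p \<bullet> mult_i (Y p) = - (Y p \<bullet> mult_i (X p))"
      "X p \<bullet> mult_i (Z p) = - (Z p \<bullet> mult_i (X p))"
      "p \<bullet> mult_i (Z p) = - (Z p \<bullet> mult_i p)"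
    using vector_fieldsD(2)[OF Y p] vector_fieldsD(2)[OF Z p]
    by (simp_all add: inner_commute[of p "Z p"] inner_commute[of p "Y p"]
          inner_mult_i_swap[of "Z p" "Y p"] inner_mult_i_swap[of "X p"] inner_mult_i_swap[of p "Z p"]
           del: mem_sphere)
  show ?thesis
    using dir_deriv_inner[where X=X, OF p vector_fieldsD(2)[OF X p] vector_fieldsD(1)[OF Y] vector_fieldsD(1)[OF Z]]
    unfolding tw_connection_def
    by (simp add: f inner_add_left inner_add_right inner_diff_left inner_diff_right
         inner_mult_i_left algebra_simps)
qed

lemma dtheta_horizontal:
  assumes X: "X \<in> horizontal_fields" and Y: "Y \<in> horizontal_fields" and p: "p \<in> usphere"
  shows "dtheta X Y p = 2 * (Y p \<bullet> mult_i (X p))"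
proof -
  note X' = horizontal_fieldsD(1)[OF X] and Y' = horizontal_fieldsD(1)[OF Y]
  have "dir_deriv X (theta Y) p = 0" "dir_deriv Y (theta X) p = 0"
    using dir_deriv_theta[OF X' Y' p] dir_deriv_theta[OF Y' X' p]
      dir_deriv_horizontal[OF X' Y p] dir_deriv_horizontal[OF Y' X p] by simp_all
  then show ?thesis
    using dir_deriv_horizontal[OF X' Y p] dir_deriv_horizontal[OF Y' X p] p
    by (simp add: dtheta_def theta_def lie_bracket_def inner_diff_left inner_mult_i_swap[of "X p"])
qed

lemma tw_connection_torsion:
  assumes X: "X \<in> horizontal_fields" and Y: "Y \<in> horizontal_fields"
  shows "torsion tw_connection X Y = (\<lambda>p. dtheta X Y p *\<^sub>R char_dir p)"
proof
  fix p
  note X' = horizontal_fieldsD(1)[OF X] and Y' = horizontal_fieldsD(1)[OF Y]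
  show "torsion tw_connection X Y p = dtheta X Y p *\<^sub>R char_dir p"
  proof (cases "p \<in> usphere")
    case p: True
    show ?thesis
      using horizontal_fieldsD(2)[OF X p] horizontal_fieldsD(2)[OF Y p] p
      by (simp add: torsion_def tw_connection_def lie_bracket_def dtheta_horizontal[OF X Y p]
          inner_commute[of "Y p" "X p"] inner_mult_i_swap[of "X p"] algebra_simps
          flip: scaleR_add_left)
  next
    case p: False
    then show ?thesis
      using tw_connection_off[OF X' Y' p] tw_connection_off[OF Y' X' p]
        vector_fieldsD(3)[OF lie_bracket_vector_field[OF X' Y'] p]
      by (simp add: torsion_def)
  qed
qed

lemma tw_connection_torsion_char_dir:
  assumes Y: "Y \<in> vector_fields"
  shows "torsion tw_connection char_dir Y = 0"
proof
  fix p :: "complex ^ 'a"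
  note T = char_dir_vector_field
  show "torsion tw_connection char_dir Y p = 0 p"
  proof (cases "p \<in> usphere")
    case p: True
    show ?thesis
      using p vector_fieldsD(2)[OF Y p]
      by (simp add: torsion_def tw_connection_def lie_bracket_def
          inner_mult_i_mult_i inner_mult_i_left norm_eq_1 algebra_simps inner_commute[of p "Y p"]
          inner_mult_i_swap[of p "Y p"] del: mem_sphere)
  next
    case p: False
    then show ?thesis
      using tw_connection_off[OF T Y p] tw_connection_off[OF Y T p]
        vector_fieldsD(3)[OF lie_bracket_vector_field[OF T Y] p]
      by (simp add: torsion_def)
  qed
qed

lemma is_tanaka_webster_tw_connection: "is_tanaka_webster tw_connection"
  unfolding is_tanaka_webster_def
  by (intro conjI ballI linear_connection_tw tw_connection_horizontal tw_connection_cr_J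
      tw_connection_metric tw_connection_torsion tw_connection_torsion_char_dir)

lemma linear_connectionD:
  assumes "linear_connection D" "X \<in> vector_fields" "Y \<in> vector_fields"
  shows "D X Y \<in> vector_fields"
    "X' \<in> vector_fields \<Longrightarrow> D (X + X') Y = D X Y + D X' Y"
    "smooth_on_sphere f \<Longrightarrow> D (\<lambda>p. f p *\<^sub>R X p) Y = (\<lambda>p. f p *\<^sub>R D X Y p)"
  using assms by (simp_all add: linear_connection_def)

lemma is_tanaka_websterD:
  assumes "is_tanaka_webster D"
  shows "linear_connection D"
    "X \<in> vector_fields \<Longrightarrow> Y \<in> horizontal_fields \<Longrightarrow> D X Y \<in> horizontal_fields"
    "X \<in> vector_fields \<Longrightarrow> Y \<in> vector_fields \<Longrightarrow> Z \<in> vector_fields \<Longrightarrow> p \<in> usphere \<Longrightarrow>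
      dir_deriv X (\<lambda>q. Y q \<bullet> Z q) p = D X Y p \<bullet> Z p + Y p \<bullet> D X Z p"
    "X \<in> horizontal_fields \<Longrightarrow> Y \<in> horizontal_fields \<Longrightarrow>
      torsion D X Y = (\<lambda>p. dtheta X Y p *\<^sub>R char_dir p)"
    "Y \<in> vector_fields \<Longrightarrow> torsion D char_dir Y = 0"
  using assms by (simp_all add: is_tanaka_webster_def)

text \<open>The component along \<open>char_dir\<close> vanishes because \<open>char_dir\<close> has constant length, and the component
  along a horizontal field \<open>Z\<close> vanishes because \<open>char_dir \<bullet> Z = 0\<close> and the derivative of \<open>Z\<close> stays horizontal.\<close>

lemma is_tanaka_webster_char_dir:
  assumes D: "is_tanaka_webster D" and X: "X \<in> vector_fields"
  shows "D X char_dir = 0"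
proof
  fix p :: "complex ^ 'a"
  note T = char_dir_vector_field
  have DT: "D X char_dir \<in> vector_fields"
    by (rule linear_connectionD(1)[OF is_tanaka_websterD(1)[OF D] X T])
  have metric: "dir_deriv X (\<lambda>q. Y q \<bullet> Z q) p = D X Y p \<bullet> Z p + Y p \<bullet> D X Z p"
    if "Y \<in> vector_fields" "Z \<in> vector_fields" "p \<in> usphere" for Y Z
    by (rule is_tanaka_websterD(3)[OF D X that])
  show "D X char_dir p = 0 p"
  proof (cases "p \<in> usphere")
    case p: True
    note tX = vector_fieldsD(2)[OF X p]
    define Z where "Z = hor (D X char_dir)"
    have Zh: "Z \<in> horizontal_fields" unfolding Z_def by (rule hor_horizontal_field[OF DT])
    note Z = horizontal_fieldsD(1)[OF Zh]
    have DZ: "D X Z \<in> horizontal_fields"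
      by (rule is_tanaka_websterD(2)[OF D X Zh])
    have "dir_deriv X (\<lambda>q. char_dir q \<bullet> char_dir q) p = dir_deriv X (\<lambda>q. 1::real) p"
      by (rule dir_deriv_cong) (simp add: inner_mult_i_mult_i norm_eq_1)
    then have 1: "D X char_dir p \<bullet> mult_i p = 0"
      using metric[OF T T p] dir_deriv_const[where X=X and c="1::real", OF p tX] p
      by (simp add: inner_commute)
    have "dir_deriv X (\<lambda>q. char_dir q \<bullet> Z q) p = dir_deriv X (\<lambda>q. 0::real) p"
      by (rule dir_deriv_cong) (simp add: inner_commute[of "mult_i _"] horizontal_fieldsD(2)[OF Zh])
    then have "D X char_dir p \<bullet> Z p = 0"
      using metric[OF T Z p] dir_deriv_const[where X=X and c="0::real", OF p tX] p
        horizontal_fieldsD(2)[OF DZ p] by (simp add: inner_commute[of "mult_i p"])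
    moreover have "Z p = D X char_dir p" using 1 p by (simp add: Z_def hor_on)
    ultimately show ?thesis by simp
  qed (use vector_fieldsD(3)[OF DT] in simp)
qed

text \<open>The difference \<open>A\<close> of two such connections satisfies \<open>A X Y = A Y X\<close> on horizontal fields, because
  the torsion is prescribed, and \<open>A X Y \<bullet> Z = - (A X Z \<bullet> Y)\<close>, because both are metric. A trilinear
  form that is symmetric in the first pair and skew in the last pair of arguments is zero (the
  Koszul argument). In the characteristic direction both connections are given by the Lie bracket,
  since \<open>char_dir\<close> is parallel.\<close>

lemma is_tanaka_webster_unique:
  assumes D: "is_tanaka_webster D" and E: "is_tanaka_webster E"
    and X: "X \<in> vector_fields" and Y: "Y \<in> horizontal_fields"
  shows "D X Y = E X Y"
proof -
  define A where "A X Y = D X Y - E X Y" for X Y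
  note T = char_dir_vector_field
  note vf = horizontal_fieldsD(1)
  have hor_eq: "D X Y = E X Y" if X: "X \<in> horizontal_fields" and Y: "Y \<in> horizontal_fields" for X Y
  proof
    fix p
    have clos: "D X Y \<in> horizontal_fields" "E X Y \<in> horizontal_fields" 
      by (rule is_tanaka_websterD(2)[OF D vf[OF X] Y], rule is_tanaka_websterD(2)[OF E vf[OF X] Y])
    have sym: "A X Y = A Y X" if "X \<in> horizontal_fields" "Y \<in> horizontal_fields" for X Y
    proof -
      have "torsion D X Y = torsion E X Y"
        using is_tanaka_websterD(4)[OF D that] is_tanaka_websterD(4)[OF E that] by simp
      then show ?thesis by (simp add: torsion_def A_def algebra_simps)
    qed
    show "D X Y p = E X Y p"
    proof (cases "p \<in> usphere")
      case p: True
      have skew: "A X Y p \<bullet> Z p = - (A X Z p \<bullet> Y p)"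
        if "X \<in> horizontal_fields" "Y \<in> horizontal_fields" "Z \<in> horizontal_fields" for X Y Z
      proof -
        have "D X Y p \<bullet> Z p + Y p \<bullet> D X Z p = E X Y p \<bullet> Z p + Y p \<bullet> E X Z p"
          using is_tanaka_websterD(3)[OF D vf[OF that(1)] vf[OF that(2)] vf[OF that(3)] p]
            is_tanaka_websterD(3)[OF E vf[OF that(1)] vf[OF that(2)] vf[OF that(3)] p] by simp
        then show ?thesis by (simp add: A_def inner_diff_left inner_diff_right inner_commute)
      qed
      have AZ: "A X Y \<in> horizontal_fields"
        using clos vector_fields_diff[OF vf vf, of "D X Y" "E X Y"]
        by (auto simp: A_def inner_diff_left horizontal_fieldsD(2) intro!: horizontal_fieldsI simp del: mem_sphere)
      define Z where "Z = A X Y"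
      have Zh: "Z \<in> horizontal_fields" using AZ by (simp add: Z_def)
      \<comment> \<open>Six alternating exchanges of neighbouring arguments return to the start with the sign reversed.\<close>
      have "A X Y p \<bullet> Z p = - (A X Y p \<bullet> Z p)"
        using skew[OF X Y Zh] skew[OF Zh X Y] skew[OF Y Zh X]
          sym[OF X Zh] sym[OF Zh Y] sym[OF Y X] by simp
      then show ?thesis by (simp add: Z_def A_def)
    qed (simp add: vector_fieldsD(3)[OF vf[OF clos(1)]] vector_fieldsD(3)[OF vf[OF clos(2)]] del: mem_sphere)
  qed
  have char_eq: "D char_dir Y = E char_dir Y"
  proof -
    have "torsion D char_dir Y = 0" "torsion E char_dir Y = 0"
      by (rule is_tanaka_websterD(5)[OF D vf[OF Y]], rule is_tanaka_websterD(5)[OF E vf[OF Y]])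
    then have "D char_dir Y - lie_bracket char_dir Y = 0" "E char_dir Y - lie_bracket char_dir Y = 0"
      using is_tanaka_webster_char_dir[OF D vf[OF Y]] is_tanaka_webster_char_dir[OF E vf[OF Y]]
      by (simp_all add: torsion_def)
    then show ?thesis by simp
  qed
  have st: "smooth_on_sphere (theta X)"
    unfolding theta_def using X T by (intro smooth_intros)
  have dec: "X = hor X + (\<lambda>p. theta X p *\<^sub>R char_dir p)"
    by (rule ext) (simp add: hor_def theta_def)
  have *: "F X Y = F (hor X) Y + (\<lambda>p. theta X p *\<^sub>R F char_dir Y p)" if F: "is_tanaka_webster F" for F
  proof -
    have L: "linear_connection F" by (rule is_tanaka_websterD(1)[OF F])
    have "F (hor X + (\<lambda>p. theta X p *\<^sub>R char_dir p)) Y = F (hor X) Y + F (\<lambda>p. theta X p *\<^sub>R char_dir p) Y"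
      by (rule linear_connectionD(2)[OF L vf[OF hor_horizontal_field[OF X]] vf[OF Y]
            vector_fields_scale[OF st T]])
    moreover have "F (\<lambda>p. theta X p *\<^sub>R char_dir p) Y = (\<lambda>p. theta X p *\<^sub>R F char_dir Y p)"
      by (rule linear_connectionD(3)[OF L T vf[OF Y] st])
    ultimately show ?thesis using dec by simp
  qed
  show ?thesis
    using *[OF D] *[OF E] hor_eq[OF hor_horizontal_field[OF X] Y] char_eq by simp
qed

lemma tanaka_webster_eq:
  assumes "X \<in> vector_fields" "Y \<in> horizontal_fields"
  shows "tanaka_webster X Y = tw_connection X Y"
proof -
  have "is_tanaka_webster (tanaka_webster :: 'a cfield \<Rightarrow> _)"
    unfolding tanaka_webster_def by (rule someI[of is_tanaka_webster, OF is_tanaka_webster_tw_connection])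
  then show ?thesis
    by (rule is_tanaka_webster_unique[OF _ is_tanaka_webster_tw_connection assms])
qed

section \<open>Horizontal projections of constant vectors\<close>

text \<open>The Hermitian orthogonal projection of the constant vector \<open>a\<close> to the Levi distribution:
  \<open>a - h p\<close>, where the complex number \<open>h\<close> with real part \<open>a \<bullet> p\<close> and imaginary part
  \<open>a \<bullet> mult_i p\<close> is the Hermitian product of \<open>a\<close> and \<open>p\<close>. The same number acts as a complex scalar
  in the derivatives below.\<close>

definition test_field :: "complex ^ 'm::finite \<Rightarrow> 'm cfield" where
  "test_field a p =
    (if p \<in> usphere then a - (a \<bullet> p) *\<^sub>R p - (a \<bullet> mult_i p) *\<^sub>R mult_i p else 0)"

lemma test_field_on:
  "p \<in> usphere \<Longrightarrow> test_field a p = a - (a \<bullet> p) *\<^sub>R p - (a \<bullet> mult_i p) *\<^sub>R mult_i p"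
  by (simp add: test_field_def)

lemma test_field_horizontal: "test_field a \<in> horizontal_fields"
proof (rule horizontal_fieldsI)
  have "smooth_on_sphere (\<lambda>p. a - (a \<bullet> p) *\<^sub>R p - (a \<bullet> mult_i p) *\<^sub>R mult_i p)"
    by (intro smooth_intros)
  then have "smooth_on_sphere (test_field a)"
    by (subst smooth_on_sphere_cong[OF test_field_on])
  then show "test_field a \<in> vector_fields"
    by (auto simp: vector_fields_def test_field_def inner_diff_left norm_eq_1)
  show "test_field a p \<bullet> mult_i p = 0" if "p \<in> usphere" for p
    using that by (simp add: test_field_on inner_diff_left inner_mult_i_mult_i norm_eq_1 del: mem_sphere)
qed

lemmas test_field_vector_field = horizontal_fieldsD(1)[OF test_field_horizontal]

lemma dir_deriv_test_field:
  assumes X: "X \<in> vector_fields" and p: "p \<in> usphere"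
  shows "dir_deriv X (test_field a) p =
    - ((a \<bullet> X p) *\<^sub>R p + (a \<bullet> p) *\<^sub>R X p
        + (a \<bullet> mult_i (X p)) *\<^sub>R mult_i p + (a \<bullet> mult_i p) *\<^sub>R mult_i (X p))"
proof -
  note J = bounded_linear.has_derivative[OF bounded_linear_mult_i]
  have "((\<lambda>q. a - (a \<bullet> q) *\<^sub>R q - (a \<bullet> mult_i q) *\<^sub>R mult_i q) has_derivative
      (\<lambda>v. - ((a \<bullet> v) *\<^sub>R p + (a \<bullet> p) *\<^sub>R v
        + (a \<bullet> mult_i v) *\<^sub>R mult_i p + (a \<bullet> mult_i p) *\<^sub>R mult_i v))) (at p within usphere)"
    by (auto intro!: derivative_eq_intros J simp: algebra_simps)
  from dir_deriv_eqI[of p X _ _, OF p vector_fieldsD(2)[OF X p] this]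
  show ?thesis
    using dir_deriv_cong[of "test_field a" "\<lambda>q. a - (a \<bullet> q) *\<^sub>R q - (a \<bullet> mult_i q) *\<^sub>R mult_i q"]
    by (simp add: test_field_on)
qed

text \<open>In the derivative of \<open>a - h p\<close> along \<open>Y\<close>, with \<open>h\<close> the Hermitian product of \<open>a\<close> and \<open>p\<close>, the term
  with the derivative of \<open>h\<close> is a complex multiple of \<open>p\<close> and projects to zero. What remains is \<open>- h\<close> times
  the horizontal part of \<open>Y\<close>, apart from the rotation that comes with the characteristic component
  of \<open>Y\<close>.\<close>

lemma tw_connection_test_field:
  assumes Y: "Y \<in> vector_fields" and p: "p \<in> usphere"
  shows "tw_connection Y (test_field a) p =
    - (a \<bullet> p) *\<^sub>R hor Y p - (a \<bullet> mult_i p) *\<^sub>R cr_J Y p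
    - (Y p \<bullet> mult_i p) *\<^sub>R mult_i (test_field a p)"
proof -
  have f: "p \<bullet> p = 1" "Y p \<bullet> p = 0" "p \<bullet> Y p = 0" "p \<bullet> mult_i (Y p) = - (Y p \<bullet> mult_i p)"
    "test_field a p \<bullet> mult_i p = 0" "Y p \<bullet> a = a \<bullet> Y p"
    using p vector_fieldsD(2)[OF Y p] horizontal_fieldsD(2)[OF test_field_horizontal p]
    by (simp_all add: norm_eq_1 inner_commute[of p "Y p"] inner_mult_i_swap[of p "Y p"]
        inner_commute[of "Y p" a] del: mem_sphere)
  have g: "Y p \<bullet> test_field a p = a \<bullet> Y p - (a \<bullet> mult_i p) * (Y p \<bullet> mult_i p)"
    "test_field a p \<bullet> mult_i (Y p) = a \<bullet> mult_i (Y p) + (a \<bullet> p) * (Y p \<bullet> mult_i p)"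
    by (simp_all add: test_field_on[OF p] inner_diff_left inner_diff_right f inner_mult_i_mult_i)
  show ?thesis
    unfolding tw_connection_def dir_deriv_test_field[OF Y p] hor_on[OF p] cr_J_on[OF p] g
    by (simp add: f algebra_simps)
qed

lemma tw_connection_hh:
  assumes X: "X \<in> horizontal_fields" and Y: "Y \<in> horizontal_fields" and p: "p \<in> usphere"
  shows "tw_connection X Y p = dir_deriv X Y p + (X p \<bullet> Y p) *\<^sub>R p + (Y p \<bullet> mult_i (X p)) *\<^sub>R mult_i p"
  using horizontal_fieldsD(2)[OF X p] horizontal_fieldsD(2)[OF Y p] by (simp add: tw_connection_def)

lemma tw_connection_test_field_horizontal:
  assumes Y: "Y \<in> horizontal_fields" and p: "p \<in> usphere"
  shows "tw_connection Y (test_field a) p = - (a \<bullet> p) *\<^sub>R Y p - (a \<bullet> mult_i p) *\<^sub>R mult_i (Y p)"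
  using tw_connection_test_field[OF horizontal_fieldsD(1)[OF Y] p] horizontal_fieldsD(2)[OF Y p] p
  by (simp add: hor_on cr_J_on)

lemma tw_connection_twice_test_field:
  assumes X: "X \<in> horizontal_fields" and Y: "Y \<in> horizontal_fields" and p: "p \<in> usphere"
  shows "tw_connection X (tw_connection Y (test_field a)) p =
    - (a \<bullet> X p) *\<^sub>R Y p - (a \<bullet> mult_i (X p)) *\<^sub>R mult_i (Y p)
    - (a \<bullet> p) *\<^sub>R (dir_deriv X Y p + (X p \<bullet> Y p) *\<^sub>R p + (Y p \<bullet> mult_i (X p)) *\<^sub>R mult_i p)
    - (a \<bullet> mult_i p) *\<^sub>R (mult_i (dir_deriv X Y p) - (Y p \<bullet> mult_i (X p)) *\<^sub>R p + (X p \<bullet> Y p) *\<^sub>R mult_i p)"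
proof -
  note X' = horizontal_fieldsD(1)[OF X] and Y' = horizontal_fieldsD(1)[OF Y]
  note tX = vector_fieldsD(2)[OF X' p]
  let ?V = "test_field a"
  let ?D = "frechet_derivative Y (at p within usphere)"
  note D = smooth_on_sphere_has_derivative[OF vector_fieldsD(1)[OF Y'] p]
  note J = bounded_linear.has_derivative[OF bounded_linear_mult_i]
  have "((\<lambda>q. - (a \<bullet> q) *\<^sub>R Y q - (a \<bullet> mult_i q) *\<^sub>R mult_i (Y q)) has_derivative
      (\<lambda>v. - (a \<bullet> v) *\<^sub>R Y p - (a \<bullet> p) *\<^sub>R ?D v - (a \<bullet> mult_i v) *\<^sub>R mult_i (Y p)
        - (a \<bullet> mult_i p) *\<^sub>R mult_i (?D v))) (at p within usphere)"
    by (auto intro!: derivative_eq_intros J D simp: algebra_simps)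
  from dir_deriv_eqI[of p X _ _, OF p tX this]
  have d: "dir_deriv X (tw_connection Y ?V) p =
      - (a \<bullet> X p) *\<^sub>R Y p - (a \<bullet> p) *\<^sub>R dir_deriv X Y p
      - (a \<bullet> mult_i (X p)) *\<^sub>R mult_i (Y p) - (a \<bullet> mult_i p) *\<^sub>R mult_i (dir_deriv X Y p)"
    using dir_deriv_cong[of "tw_connection Y ?V" "\<lambda>q. - (a \<bullet> q) *\<^sub>R Y q - (a \<bullet> mult_i q) *\<^sub>R mult_i (Y q)" X p]
    by (simp add: tw_connection_test_field_horizontal[OF Y] dir_deriv_eq_frechet[OF p, of X Y] del: mem_sphere)
  have s: "X p \<bullet> mult_i (Y p) = - (Y p \<bullet> mult_i (X p))" by (rule inner_mult_i_swap)
  show ?thesis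
    unfolding tw_connection_hh[OF X tw_connection_horizontal[OF Y' test_field_horizontal] p] d
      tw_connection_test_field_horizontal[OF Y p]
    by (simp add: inner_diff_left inner_diff_right inner_mult_i_mult_i s inner_commute[of "Y p" "X p"] algebra_simps)
qed

text \<open>Since the derivative of the test field along \<open>Y\<close> is an explicit complex multiple of \<open>Y\<close>, the curvature
  is computed from first derivatives of \<open>X\<close> and \<open>Y\<close> alone, and these cancel against the bracket. The
  last summand comes from the component of the bracket in the characteristic direction. The result is
  the curvature of a space of constant holomorphic sectional curvature 4.\<close>

lemma curvature_test_field:
  assumes X: "X \<in> horizontal_fields" and Y: "Y \<in> horizontal_fields" and p: "p \<in> usphere"
  shows "curvature tanaka_webster X Y (test_field a) p =
    (a \<bullet> Y p) *\<^sub>R X p + (a \<bullet> mult_i (Y p)) *\<^sub>R mult_i (X p)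
    - (a \<bullet> X p) *\<^sub>R Y p - (a \<bullet> mult_i (X p)) *\<^sub>R mult_i (Y p)
    + (2 * (X p \<bullet> mult_i (Y p))) *\<^sub>R mult_i (test_field a p)"
proof -
  note X' = horizontal_fieldsD(1)[OF X] and Y' = horizontal_fieldsD(1)[OF Y]
  note V = test_field_horizontal
  let ?V = "test_field a" and ?Z = "lie_bracket X Y"
  note Z = lie_bracket_vector_field[OF X' Y']
  have e: "curvature tanaka_webster X Y ?V = tw_connection X (tw_connection Y ?V)
      - tw_connection Y (tw_connection X ?V) - tw_connection ?Z ?V"
    unfolding curvature_def
    by (simp add: tanaka_webster_eq X' Y' Z V tw_connection_horizontal)
  have s: "Y p \<bullet> mult_i (X p) = - (X p \<bullet> mult_i (Y p))" by (rule inner_mult_i_swap)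
  have t: "?Z p \<bullet> mult_i p = 2 * (X p \<bullet> mult_i (Y p))"
    by (simp add: lie_bracket_def inner_diff_left dir_deriv_horizontal[OF X' Y p]
        dir_deriv_horizontal[OF Y' X p] s)
  have "curvature tanaka_webster X Y ?V p = tw_connection X (tw_connection Y ?V) p
      - tw_connection Y (tw_connection X ?V) p - tw_connection ?Z ?V p"
    by (simp add: e)
  also have "\<dots> = (a \<bullet> Y p) *\<^sub>R X p + (a \<bullet> mult_i (Y p)) *\<^sub>R mult_i (X p)
    - (a \<bullet> X p) *\<^sub>R Y p - (a \<bullet> mult_i (X p)) *\<^sub>R mult_i (Y p)
    + (2 * (X p \<bullet> mult_i (Y p))) *\<^sub>R mult_i (test_field a p)"
    unfolding tw_connection_twice_test_field[OF X Y p] tw_connection_twice_test_field[OF Y X p]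
      tw_connection_test_field[OF Z p] hor_on[OF p] cr_J_on[OF p] t
    by (simp add: lie_bracket_def s inner_commute[of "Y p" "X p"] mult_i_linear_simps algebra_simps)
      (simp only: mult_2 mult_2_right scaleR_add_left scaleR_add_right distrib_left add_ac)
  finally show ?thesis .
qed

section \<open>Orthonormal frames of the Levi distribution\<close>

text \<open>Orthonormality makes the \<open>e l\<close> independent, and there are as many of them as the dimension of \<open>H\<close>,
  so they span it.\<close>

lemma orthonormal_frame_Parseval:
  fixes H :: "'a::euclidean_space set" and e :: "nat \<Rightarrow> 'a"
  assumes "subspace H" "dim H = N" "\<And>l. l \<in> {1..N} \<Longrightarrow> e l \<in> H"
    and on: "\<And>l k. l \<in> {1..N} \<Longrightarrow> k \<in> {1..N} \<Longrightarrow> e l \<bullet> e k = (if l = k then 1 else 0)"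
    and v: "v \<in> H"
  shows "(\<Sum>l = 1..N. (v \<bullet> e l)\<^sup>2) = v \<bullet> v"
proof -
  have inj: "inj_on e {1..N}"
    by (rule inj_onI) (metis on zero_neq_one)
  let ?B = "e ` {1..N}"
  have card: "card ?B = N" using card_image[OF inj] by simp
  have "pairwise orthogonal ?B"
    by (auto simp: pairwise_def orthogonal_def on)
  moreover have "0 \<notin> ?B"
    using on by (metis (no_types, lifting) image_iff inner_zero_left zero_neq_one)
  ultimately have "independent ?B" by (rule pairwise_orthogonal_independent)
  then have "H \<subseteq> span ?B"
    using assms(1-3) card by (intro card_ge_dim_independent) auto
  then have "v \<in> span ?B" using v by blast
  \<comment> \<open>The expansion \<open>w\<close> of \<open>v\<close> differs from \<open>v\<close> by a vector of the span that is orthogonal to the span.\<close>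
  define w where "w = (\<Sum>l = 1..N. (v \<bullet> e l) *\<^sub>R e l)"
  have "w \<bullet> e k = v \<bullet> e k" if "k \<in> {1..N}" for k
    using that by (simp add: w_def inner_sum_left on if_distrib cong: if_cong)
  then have "orthogonal (v - w) b" if "b \<in> ?B" for b
    using that by (auto simp: orthogonal_def inner_diff_left)
  then have orth: "orthogonal (v - w) b" if "b \<in> span ?B" for b
    using orthogonal_to_span that by blast
  have "w \<in> span ?B"
    unfolding w_def by (intro span_sum span_scale span_base) auto
  then have "v - w \<in> span ?B" using \<open>v \<in> span ?B\<close> by (rule span_diff[rotated])
  then have "v = w" using orth[of "v - w"] by (simp add: orthogonal_self)
  then have "v \<bullet> v = v \<bullet> w" by simp
  then show ?thesis by (simp add: w_def inner_sum_right power2_eq_square)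
qed

definition levi_space :: "complex ^ 'm::finite \<Rightarrow> (complex ^ 'm) set" where
  "levi_space p = {v. v \<bullet> p = 0 \<and> v \<bullet> mult_i p = 0}"

lemma subspace_levi_space: "subspace (levi_space p)"
  by (auto simp: subspace_def levi_space_def inner_add_left)

lemma DIM_complex_vec: "DIM(complex ^ 'm::finite) = 2 * CARD('m)"
  by simp

lemma dim_levi_space:
  fixes p :: "complex ^ 'm::finite"
  assumes p: "p \<in> usphere"
  shows "dim (levi_space p) = 2 * (CARD('m) - 1)"
proof -
  let ?A = "{p, mult_i p}"
  have n: "p \<bullet> p = 1" using p by (simp add: norm_eq_1)
  then have "p \<noteq> mult_i p" by (metis inner_mult_i_self(1) zero_neq_one)
  have "0 \<notin> ?A" using n by (metis inner_mult_i_mult_i inner_zero_left insertE singletonD zero_neq_one)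
  moreover have "pairwise orthogonal ?A" 
    by (auto simp: pairwise_def orthogonal_def)
  ultimately have "independent ?A" by (rule pairwise_orthogonal_independent[rotated])
  then have "dim (span ?A) = card ?A" by (simp add: dim_eq_card_independent)
  also have "\<dots> = 2" using \<open>p \<noteq> mult_i p\<close> by simp
  finally have d2: "dim (span ?A) = 2" .
  have "levi_space p = {y \<in> UNIV. \<forall>x\<in>span ?A. orthogonal x y}"
  proof safe
    fix v x assume "v \<in> levi_space p" "x \<in> span ?A"
    then have "orthogonal v x"
      by (intro orthogonal_to_span[of x ?A]) (auto simp: levi_space_def orthogonal_def)
    then show "orthogonal x v" by (simp add: orthogonal_commute)
  next
    fix v assume "\<forall>x\<in>span ?A. orthogonal x v"
    then have "orthogonal p v" "orthogonal (mult_i p) v" by (auto intro: span_base)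
    then show "v \<in> levi_space p" by (simp add: levi_space_def orthogonal_def inner_commute)
  qed auto
  then have "dim (levi_space p) + 2 = 2 * CARD('m)"
    using dim_subspace_orthogonal_to_vectors[of "span ?A" UNIV] d2
    by (simp add: DIM_complex_vec)
  then show ?thesis by simp
qed

lemma horizontal_fields_in_levi_space:
  "X \<in> horizontal_fields \<Longrightarrow> p \<in> usphere \<Longrightarrow> X p \<in> levi_space p"
  by (simp add: levi_space_def vector_fieldsD(2) horizontal_fieldsD del: mem_sphere)

lemma mult_i_levi_space: "v \<in> levi_space p \<Longrightarrow> mult_i v \<in> levi_space p"
  by (simp add: levi_space_def inner_mult_i_mult_i inner_mult_i_left)

lemma test_field_levi_space:
  "p \<in> usphere \<Longrightarrow> v \<in> levi_space p \<Longrightarrow> test_field v p = v"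
  by (simp add: test_field_on levi_space_def)

text \<open>The density refers to a chosen frame of global fields with prescribed values at \<open>p\<close>. The test fields
  of an orthonormal basis of the Levi space at \<open>p\<close> provide one, as they extend their own values.\<close>

lemma horizontal_frame_exists:
  fixes p :: "complex ^ 'm::finite"
  assumes p: "p \<in> usphere"
  shows "\<exists>e. horizontal_frame_at p e"
proof -
  obtain B where B: "B \<subseteq> levi_space p" "pairwise orthogonal B" "\<And>x. x \<in> B \<Longrightarrow> norm x = 1"
    "independent B" "card B = dim (levi_space p)"
    using orthonormal_basis_subspace[OF subspace_levi_space, of p] by metis
  let ?N = "2 * (CARD('m) - 1)"
  have "finite B" using B(4) by (rule independent_imp_finite)
  moreover have "card {1..?N} = card B" using B(5) dim_levi_space[OF p] by simp
  ultimately obtain f where f: "bij_betw f {1..?N} B"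
    using finite_same_card_bij[of "{1..?N}" B] by blast
  have fB: "f l \<in> B" if "l \<in> {1..?N}" for l using f that by (auto simp: bij_betw_def)
  have v: "test_field (f l) p = f l" if "l \<in> {1..?N}" for l
    using test_field_levi_space[OF p] fB[OF that] B(1) by blast
  have "f l \<bullet> f k = (if l = k then 1 else 0)" if "l \<in> {1..?N}" "k \<in> {1..?N}" for l k
  proof (cases "l = k")
    case True
    then show ?thesis using B(3)[OF fB[OF that(1)]] by (simp add: norm_eq_1)
  next
    case False
    then have "f l \<noteq> f k" using f that by (auto simp: bij_betw_def inj_on_def)
    then show ?thesis using B(2) fB that False by (auto simp: pairwise_def orthogonal_def)
  qed
  then have "horizontal_frame_at p (\<lambda>l. test_field (f l))"
    using v unfolding horizontal_frame_at_def by (simp add: test_field_horizontal)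
  then show ?thesis by blast
qed

section \<open>The second variation density\<close>

text \<open>Write \<open>v\<close> for the value of the test field and \<open>c\<close> for the squared modulus of the Hermitian product
  of \<open>a\<close> and \<open>p\<close>, so that \<open>v \<bullet> v = a \<bullet> a - c\<close>. Each of the \<open>2 n\<close> frame vectors \<open>x\<close> contributes
  \<open>c\<close> to the gradient term and the curvature term
  \<open>- (v \<bullet> v) + (v \<bullet> x)\<^sup>2 - 3 (mult_i v \<bullet> x)\<^sup>2\<close>. Summing with Parseval's identity for \<open>v\<close> and
  \<open>mult_i v\<close> gives \<open>2 n c - (2 n + 2) (v \<bullet> v)\<close>.\<close>

lemma second_variation_density_test_field:
  fixes a p :: "complex ^ 'm::finite"
  assumes p: "p \<in> usphere"
  shows "second_variation_density (test_field a) p =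
    (4 * real CARD('m) - 2) * ((a \<bullet> p)\<^sup>2 + (a \<bullet> mult_i p)\<^sup>2) - 2 * real CARD('m) * (a \<bullet> a)"
proof -
  let ?N = "2 * (CARD('m) - 1)" and ?V = "test_field a" and ?v = "test_field a p"
  define c where "c = (a \<bullet> p)\<^sup>2 + (a \<bullet> mult_i p)\<^sup>2"
  define e where "e = (SOME e. horizontal_frame_at p e)"
  have e: "horizontal_frame_at p e"
    unfolding e_def by (rule someI_ex[OF horizontal_frame_exists[OF p]])
  have eh: "e l \<in> horizontal_fields" if "l \<in> {1..?N}" for l
    using e that by (simp add: horizontal_frame_at_def)
  have on: "e l p \<bullet> e k p = (if l = k then 1 else 0)" if "l \<in> {1..?N}" "k \<in> {1..?N}" for l k
    using e that by (simp add: horizontal_frame_at_def)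
  note V = test_field_horizontal[of a]
  have n: "p \<bullet> p = 1" using p by (simp add: norm_eq_1)
  have vL: "?v \<in> levi_space p" by (rule horizontal_fields_in_levi_space[OF V p])
  have a_eq: "a \<bullet> x = ?v \<bullet> x" if "x \<in> levi_space p" for x
    using that by (simp add: test_field_on[OF p] inner_diff_left levi_space_def inner_commute[of p x] inner_commute[of "mult_i p" x])
  have vv: "?v \<bullet> ?v = a \<bullet> a - c"
    by (simp add: a_eq[OF vL, symmetric]) (simp add: test_field_on[OF p] inner_diff_right c_def power2_eq_square)
  have summand: "tanaka_webster (e l) (hor ?V) p \<bullet> tanaka_webster (e l) (hor ?V) p
      - curvature4 tanaka_webster ?V (e l) ?V (e l) p
      = c - ?v \<bullet> ?v + (?v \<bullet> e l p)\<^sup>2 - 3 * (mult_i ?v \<bullet> e l p)\<^sup>2" if l: "l \<in> {1..?N}" for l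
  proof -
    let ?x = "e l p"
    note E = eh[OF l]
    have xL: "?x \<in> levi_space p" by (rule horizontal_fields_in_levi_space[OF E p])
    have xx: "?x \<bullet> ?x = 1" using on[OF l l] by simp
    have "tanaka_webster (e l) (hor ?V) p = - (a \<bullet> p) *\<^sub>R ?x - (a \<bullet> mult_i p) *\<^sub>R mult_i ?x"
      using tanaka_webster_eq[OF horizontal_fieldsD(1)[OF E] V] tw_connection_test_field_horizontal[OF E p]
      by (simp add: hor_horizontal[OF V])
    then have 1: "tanaka_webster (e l) (hor ?V) p \<bullet> tanaka_webster (e l) (hor ?V) p = c"
      by (simp add: inner_diff_left inner_diff_right inner_mult_i_mult_i xx c_def power2_eq_square)
    have s: "?v \<bullet> mult_i ?x = - (mult_i ?v \<bullet> ?x)" by (simp add: inner_mult_i_left)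
    have "curvature tanaka_webster ?V (e l) ?V p =
        (?v \<bullet> ?x) *\<^sub>R ?v - (mult_i ?v \<bullet> ?x) *\<^sub>R mult_i ?v - (?v \<bullet> ?v) *\<^sub>R ?x
          - (2 * (mult_i ?v \<bullet> ?x)) *\<^sub>R mult_i ?v"
      unfolding curvature_test_field[OF V E p] a_eq[OF xL] a_eq[OF vL]
        a_eq[OF mult_i_levi_space[OF xL]] a_eq[OF mult_i_levi_space[OF vL]] s
      by simp
    then have "curvature4 tanaka_webster ?V (e l) ?V (e l) p
        = ?v \<bullet> ?v - (?v \<bullet> ?x)\<^sup>2 + 3 * (mult_i ?v \<bullet> ?x)\<^sup>2"
      by (simp add: curvature4_def inner_diff_left xx power2_eq_square)
    then show ?thesis using 1 by simp
  qed
  have P: "(\<Sum>l = 1..?N. (v \<bullet> e l p)\<^sup>2) = v \<bullet> v" if "v \<in> levi_space p" for v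
    using orthonormal_frame_Parseval[OF subspace_levi_space dim_levi_space[OF p], of "\<lambda>l. e l p" v]
      horizontal_fields_in_levi_space[OF eh p] on that by blast
  have "second_variation_density ?V p =
      (\<Sum>l = 1..?N. c - ?v \<bullet> ?v + (?v \<bullet> e l p)\<^sup>2 - 3 * (mult_i ?v \<bullet> e l p)\<^sup>2)"
    unfolding second_variation_density_def Let_def e_def[symmetric]
    by (rule sum.cong[OF refl summand])
  also have "\<dots> = real ?N * (c - ?v \<bullet> ?v) + ?v \<bullet> ?v - 3 * (?v \<bullet> ?v)"
    using P[OF vL] P[OF mult_i_levi_space[OF vL]]
    by (simp add: sum.distrib sum_subtractf sum_distrib_left[symmetric] inner_mult_i_mult_i)
  also have "real ?N = 2 * real CARD('m) - 2"
    using zero_less_card_finite[where 'a='m] by (simp add: of_nat_diff)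
  finally show ?thesis unfolding vv c_def[symmetric] by (simp add: algebra_simps)
qed

section \<open>Second moments of the sphere volume\<close>

lemma scale_measure_eq_density: "scale_measure r M = density M (\<lambda>_. r)"
  by (rule measure_eqI) (simp_all add: emeasure_density nn_integral_cmult_indicator)

lemma space_sphere_volume: "space (sphere_volume :: 'a::euclidean_space measure) = usphere"
  by (simp add: sphere_volume_def space_scale_measure)

lemma sets_sphere_volume:
  "sets (sphere_volume :: 'a::euclidean_space measure) = sets (restrict_space borel usphere)"
  by (simp add: sphere_volume_def)

lemma measurable_sgn_sphere:
  "(sgn :: 'a::euclidean_space \<Rightarrow> 'a) \<in>
    measurable (restrict_space lborel (ball 0 1 - {0})) (restrict_space borel usphere)"
  by (rule measurable_restrict_space3) (auto simp: norm_sgn)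

lemma borel_measurable_sphere_volume:
  "f \<in> borel_measurable borel \<Longrightarrow> f \<in> borel_measurable (sphere_volume :: 'a::euclidean_space measure)"
  by (simp add: measurable_cong_sets[OF sets_sphere_volume refl] measurable_restrict_space1)

lemma integral_sphere_volume:
  fixes f :: "'a::euclidean_space \<Rightarrow> real"
  assumes f: "f \<in> borel_measurable borel"
  shows "(LINT p|sphere_volume. f p) =
    real DIM('a) * (LINT x|lborel. indicator (ball 0 1 - {0}) x * f (sgn x))"
proof -
  let ?B = "ball 0 1 - {0} :: 'a set" and ?S = "restrict_space borel (usphere :: 'a set)"
  have fS: "f \<in> borel_measurable ?S" by (rule measurable_restrict_space1[OF f])
  have "(LINT p|sphere_volume. f p) =
      (LINT p|distr (restrict_space lborel ?B) ?S sgn. real DIM('a) *\<^sub>R f p)"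
    unfolding sphere_volume_def scale_measure_eq_density
    by (rule integral_density) (use fS in auto)
  also have "\<dots> = real DIM('a) * (LINT p|distr (restrict_space lborel ?B) ?S sgn. f p)"
    by simp
  also have "(LINT p|distr (restrict_space lborel ?B) ?S sgn. f p) =
      (LINT x|restrict_space lborel ?B. f (sgn x))"
    by (rule integral_distr[OF measurable_sgn_sphere fS])
  also have "\<dots> = (LINT x|lborel. indicator ?B x * f (sgn x))"
    by (subst integral_restrict_space) auto
  finally show ?thesis .
qed

lemma emeasure_sphere_volume:
  "emeasure (sphere_volume :: 'a::euclidean_space measure) usphere =
    ennreal (real DIM('a)) * emeasure lborel (ball 0 1 - {0} :: 'a set)"
proof -
  let ?B = "ball 0 1 - {0} :: 'a set" and ?S = "restrict_space borel (usphere :: 'a set)"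
  have "emeasure (distr (restrict_space lborel ?B) ?S sgn) usphere =
      emeasure (restrict_space lborel ?B) (sgn -` usphere \<inter> space (restrict_space lborel ?B))"
    by (rule emeasure_distr[OF measurable_sgn_sphere]) (metis sets.top space_restrict_space2 closed_sphere borel_closed)
  also have "sgn -` usphere \<inter> space (restrict_space lborel ?B) = ?B"
    by (auto simp: space_restrict_space norm_sgn)
  also have "emeasure (restrict_space lborel ?B) ?B = emeasure lborel ?B"
    by (subst emeasure_restrict_space) auto
  finally show ?thesis by (simp add: sphere_volume_def)
qed

lemma finite_measure_sphere_volume: "finite_measure (sphere_volume :: 'a::euclidean_space measure)"
proof
  have "emeasure lborel (ball 0 1 - {0} :: 'a set) \<le> emeasure lborel (ball 0 1 :: 'a set)"
    by (rule emeasure_mono) auto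
  also have "\<dots> < \<infinity>" by (rule emeasure_lborel_ball_finite)
  finally show "emeasure (sphere_volume :: 'a measure) (space sphere_volume) \<noteq> \<infinity>"
    unfolding space_sphere_volume emeasure_sphere_volume
    by (simp add: ennreal_mult_eq_top_iff)
qed

lemma measure_sphere_volume_pos: "measure (sphere_volume :: 'a::euclidean_space measure) usphere > 0"
proof -
  interpret finite_measure "sphere_volume :: 'a measure" by (rule finite_measure_sphere_volume)
  obtain b :: 'a where "b \<in> Basis" using nonempty_Basis by blast
  then have "(1/2) *\<^sub>R b \<in> ball 0 1 - {0}" by (auto simp: nonzero_Basis)
  then have "ball 0 1 - {0} \<noteq> ({} :: 'a set)" by blast
  then have "\<not> negligible (ball 0 1 - {0} :: 'a set)"
    using open_not_negligible open_delete[OF open_ball] by blast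
  then have "emeasure lborel (ball 0 1 - {0} :: 'a set) \<noteq> 0"
    by (simp add: negligible_iff_emeasure0)
  then have "emeasure (sphere_volume :: 'a measure) usphere \<noteq> 0"
    unfolding emeasure_sphere_volume by simp
  then show ?thesis
    by (simp add: emeasure_eq_measure zero_less_measure_iff)
qed

lemma integrable_sphere_volume:
  fixes f :: "'a::euclidean_space \<Rightarrow> real"
  assumes "continuous_on UNIV f"
  shows "integrable sphere_volume f"
proof -
  interpret finite_measure "sphere_volume :: 'a measure" by (rule finite_measure_sphere_volume)
  have "compact (f ` usphere)"
    by (rule compact_continuous_image[OF continuous_on_subset[OF assms subset_UNIV] compact_sphere])
  then obtain C where C: "\<forall>y\<in>f ` usphere. norm y \<le> C"
    unfolding bounded_iff by (auto dest!: compact_imp_bounded simp: bounded_iff simp del: mem_sphere)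
  have "AE p in sphere_volume. norm (f p) \<le> C"
    by (rule AE_I2) (use C in \<open>simp add: space_sphere_volume\<close>)
  then show ?thesis
    by (rule integrable_const_bound)
      (rule borel_measurable_sphere_volume[OF borel_measurable_continuous_onI[OF assms]])
qed

text \<open>A linear isometry commutes with \<open>sgn\<close> and preserves the punctured unit ball, through which the sphere
  volume is defined.\<close>

lemma integral_sphere_volume_isometry:
  fixes f :: "'a::euclidean_space \<Rightarrow> real" and T :: "'a \<Rightarrow> 'a"
  assumes f: "f \<in> borel_measurable borel" and T: "linear T" "\<And>x. norm (T x) = norm x"
    and lb: "distr lborel borel T = lborel"
  shows "(LINT p|sphere_volume. f (T p)) = (LINT p|sphere_volume. f p)"
proof -
  have Tm: "T \<in> borel_measurable borel"
    using T(1) by (intro borel_measurable_continuous_onI linear_continuous_on linear_linear[THEN iffD2])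
  note [measurable] = f Tm
  have "sgn (T x) = T (sgn x)" for x
    by (simp add: sgn_div_norm T(2) linear_cmul[OF T(1)])
  moreover have "indicator (ball 0 1 - {0}) (T x) = (indicator (ball 0 1 - {0}) x :: real)" for x
    using T(2)[of x] linear_0[OF T(1)] norm_eq_zero[of "T x"] norm_eq_zero[of x]
    by (simp add: indicator_def)
  ultimately have "(LINT x|lborel. indicator (ball 0 1 - {0}) x * f (T (sgn x))) =
      (LINT x|lborel. indicator (ball 0 1 - {0}) (T x) * f (sgn (T x)))" by simp
  also have "\<dots> = (LINT y|distr lborel borel T. indicator (ball 0 1 - {0}) y * f (sgn y))"
  proof (rule integral_distr[symmetric])
    have [measurable]: "(ball 0 1 - {0} :: 'a set) \<in> sets borel" by auto
    show "(\<lambda>y. indicator (ball 0 1 - {0}) y * f (sgn y)) \<in> borel_measurable borel" by measurable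
  qed simp
  finally show ?thesis
    unfolding lb by (simp add: integral_sphere_volume)
qed

lemma lborel_distr_flip:
  fixes b :: "'a::euclidean_space"
  assumes b: "b \<in> Basis"
  shows "distr lborel borel (\<lambda>x. x - (2 * (x \<bullet> b)) *\<^sub>R b) = lborel"
proof -
  define c where "c j = (if j = b then - 1 else 1 :: real)" for j
  have "0 + (\<Sum>j\<in>Basis. (c j * (x \<bullet> j)) *\<^sub>R j) = x - (2 * (x \<bullet> b)) *\<^sub>R b" for x
  proof -
    have "0 + (\<Sum>j\<in>Basis. (c j * (x \<bullet> j)) *\<^sub>R j) =
        (\<Sum>j\<in>Basis. (x \<bullet> j) *\<^sub>R j - (if j = b then (2 * (x \<bullet> b)) *\<^sub>R b else 0))"
      by (auto simp: c_def intro!: sum.cong) (simp add: algebra_simps flip: scaleR_2)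
    also have "\<dots> = x - (2 * (x \<bullet> b)) *\<^sub>R b"
      using b by (simp add: sum_subtractf euclidean_representation)
    finally show ?thesis .
  qed
  moreover have "(\<Prod>j\<in>Basis. \<bar>c j\<bar>) = 1" by (rule prod.neutral) (simp add: c_def)
  moreover have "c j \<noteq> 0" for j by (simp add: c_def)
  ultimately show ?thesis
    using lborel_affine_euclidean[of c 0] by (simp add: density_1 one_ennreal_def[symmetric])
qed

text \<open>The map is the reflection in the hyperplane orthogonal to \<open>b - d\<close>; it exchanges the coordinates
  along \<open>b\<close> and \<open>d\<close>, so it maps boxes to boxes with the same edge lengths.\<close>

lemma lborel_distr_swap:
  fixes b d :: "'a::euclidean_space"
  assumes b: "b \<in> Basis" and d: "d \<in> Basis"
  defines "T \<equiv> \<lambda>x. x - (x \<bullet> b - x \<bullet> d) *\<^sub>R (b - d)"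
  shows "distr lborel borel T = lborel"
proof (rule lborel_eqI[symmetric])
  let ?s = "Transposition.transpose b d"
  have Tj: "T x \<bullet> j = x \<bullet> ?s j" if "j \<in> Basis" for x j
    using b d that by (auto simp: T_def inner_diff_left inner_Basis Transposition.transpose_def)
  have sB: "?s j \<in> Basis" if "j \<in> Basis" for j using b d that by (auto simp: Transposition.transpose_def)
  have [measurable]: "T \<in> borel_measurable borel"
    unfolding T_def by (intro borel_measurable_continuous_onI continuous_intros)
  fix l u :: 'a assume le: "\<And>b. b \<in> Basis \<Longrightarrow> l \<bullet> b \<le> u \<bullet> b"
  have "T -` box l u = box (T l) (T u)"
    unfolding box_def using Tj sB by (auto simp: Tj) (metis transpose_involutory)+
  then have "emeasure (distr lborel borel T) (box l u) = emeasure lborel (box (T l) (T u))"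
    by (simp add: emeasure_distr)
  also have "\<dots> = ennreal (\<Prod>j\<in>Basis. (T u - T l) \<bullet> j)"
    using le sB by (intro emeasure_lborel_box) (simp add: Tj)
  also have "(\<Prod>j\<in>Basis. (T u - T l) \<bullet> j) = (\<Prod>j\<in>Basis. (u - l) \<bullet> ?s j)"
    by (rule prod.cong) (simp_all add: inner_diff_left Tj)
  also have "\<dots> = (\<Prod>j\<in>Basis. (u - l) \<bullet> j)"
    by (rule prod.reindex_bij_witness[of _ ?s ?s]) (use sB in auto)
  finally show "emeasure (distr lborel borel T) (box l u) = ennreal (\<Prod>b\<in>Basis. (u - l) \<bullet> b)" .
qed simp

lemma sphere_volume_cross_moment:
  fixes b d :: "'a::euclidean_space"
  assumes b: "b \<in> Basis" and d: "d \<in> Basis" and "b \<noteq> d"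
  shows "(LINT p|sphere_volume. (p \<bullet> b) * (p \<bullet> d)) = 0"
proof -
  let ?T = "\<lambda>x::'a. x - (2 * (x \<bullet> b)) *\<^sub>R b"
  have lin: "linear ?T"
    by (rule linearI) (simp_all add: inner_add_left algebra_simps)
  have bb: "b \<bullet> b = 1" "b \<bullet> d = 0" using assms by (simp_all add: inner_Basis)
  have norm: "norm (?T x) = norm x" for x
    unfolding norm_eq_sqrt_inner
    by (simp add: inner_diff_left inner_diff_right bb inner_commute[of b x])
  have "(LINT p|sphere_volume. (?T p \<bullet> b) * (?T p \<bullet> d)) = (LINT p|sphere_volume. (p \<bullet> b) * (p \<bullet> d))"
    by (rule integral_sphere_volume_isometry[OF _ lin norm lborel_distr_flip[OF b]]) measurable
  then show ?thesis by (simp add: inner_diff_left bb)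
qed

lemma sphere_volume_square_moment_eq:
  fixes b d :: "'a::euclidean_space"
  assumes b: "b \<in> Basis" and d: "d \<in> Basis"
  shows "(LINT p|sphere_volume. (p \<bullet> b)\<^sup>2) = (LINT p|sphere_volume. (p \<bullet> d)\<^sup>2)"
proof (cases "b = d")
  case False
  let ?T = "\<lambda>x::'a. x - (x \<bullet> b - x \<bullet> d) *\<^sub>R (b - d)"
  have lin: "linear ?T"
    by (rule linearI) (simp_all add: inner_add_left algebra_simps)
  have bb: "b \<bullet> b = 1" "b \<bullet> d = 0" "d \<bullet> b = 0" "d \<bullet> d = 1" using assms False by (simp_all add: inner_Basis)
  have norm: "norm (?T x) = norm x" for x
    unfolding norm_eq_sqrt_inner
    by (simp add: inner_diff_left inner_diff_right bb inner_commute[of b x] inner_commute[of d x] algebra_simps)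
  have "(LINT p|sphere_volume. (?T p \<bullet> d)\<^sup>2) = (LINT p|sphere_volume. (p \<bullet> d)\<^sup>2)"
    by (rule integral_sphere_volume_isometry[OF _ lin norm lborel_distr_swap[OF b d]]) measurable
  then show ?thesis by (simp add: inner_diff_left bb)
qed simp

text \<open>Reflecting one coordinate shows that the mixed moments vanish, and exchanging two coordinates shows
  that all the pure second moments agree. The pure moments add up to the volume because
  \<open>p \<bullet> p = 1\<close>.\<close>

lemma sphere_volume_second_moment:
  fixes a :: "'a::euclidean_space"
  shows "real DIM('a) * (LINT p|sphere_volume. (a \<bullet> p)\<^sup>2) = (a \<bullet> a) * measure (sphere_volume :: 'a measure) usphere"
proof -
  interpret finite_measure "sphere_volume :: 'a measure" by (rule finite_measure_sphere_volume)
  let ?vol = "measure (sphere_volume :: 'a measure) usphere"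
  obtain b0 :: 'a where b0: "b0 \<in> Basis" using nonempty_Basis by blast
  define M where "M = (LINT p|sphere_volume. (p \<bullet> b0)\<^sup>2)"
  have int: "integrable sphere_volume (\<lambda>p::'a. c * ((p \<bullet> b) * (p \<bullet> d)))" for b d c
    by (intro integrable_sphere_volume continuous_intros)
  have int2: "integrable sphere_volume (\<lambda>p::'a. (p \<bullet> b)\<^sup>2)" for b
    by (intro integrable_sphere_volume continuous_intros)
  have mom: "(LINT p|sphere_volume. (p \<bullet> b) * (p \<bullet> d)) = (if d = b then M else 0)"
    if "b \<in> Basis" "d \<in> Basis" for b d :: 'a
    using sphere_volume_cross_moment[OF that] sphere_volume_square_moment_eq[OF that(1) b0]
    by (auto simp: M_def power2_eq_square)
  have "(LINT p|sphere_volume. (a \<bullet> p)\<^sup>2) =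
      (LINT p|sphere_volume. (\<Sum>b\<in>Basis. \<Sum>d\<in>Basis. ((a \<bullet> b) * (a \<bullet> d)) * ((p \<bullet> b) * (p \<bullet> d))))"
    by (subst euclidean_inner) (simp add: power2_eq_square sum_product mult_ac)
  also have "\<dots> = (\<Sum>b\<in>Basis. LINT p|sphere_volume. (\<Sum>d\<in>Basis. ((a \<bullet> b) * (a \<bullet> d)) * ((p \<bullet> b) * (p \<bullet> d))))"
    by (intro Bochner_Integration.integral_sum Bochner_Integration.integrable_sum int)
  also have "\<dots> = (\<Sum>b\<in>Basis. \<Sum>d\<in>Basis. LINT p|sphere_volume. ((a \<bullet> b) * (a \<bullet> d)) * ((p \<bullet> b) * (p \<bullet> d)))"
    by (intro sum.cong refl Bochner_Integration.integral_sum int)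
  also have "\<dots> = (\<Sum>b\<in>Basis. \<Sum>d\<in>Basis. ((a \<bullet> b) * (a \<bullet> d)) * (if d = b then M else 0))"
    by (intro sum.cong refl) (simp add: mom)
  also have "\<dots> = (a \<bullet> a) * M"
    by (simp add: if_distrib sum_distrib_right euclidean_inner[of a a] cong: if_cong)
  finally have 1: "(LINT p|sphere_volume. (a \<bullet> p)\<^sup>2) = (a \<bullet> a) * M" .
  have "?vol = (LINT p|(sphere_volume :: 'a measure). (1::real))"
    by (simp add: space_sphere_volume)
  also have "\<dots> = (LINT p|sphere_volume. (\<Sum>b\<in>(Basis :: 'a set). (p \<bullet> b)\<^sup>2))"
  proof (rule Bochner_Integration.integral_cong[OF refl])
    fix p :: 'a assume "p \<in> space sphere_volume"
    then have "p \<bullet> p = 1" by (simp add: space_sphere_volume norm_eq_1)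
    then show "1 = (\<Sum>b\<in>Basis. (p \<bullet> b)\<^sup>2)"
      by (simp add: euclidean_inner[of p p] power2_eq_square)
  qed
  also have "\<dots> = (\<Sum>b\<in>(Basis::'a set). M)"
    unfolding Bochner_Integration.integral_sum[OF int2]
    by (rule sum.cong) (simp_all add: M_def sphere_volume_square_moment_eq[OF _ b0])
  finally have "?vol = real DIM('a) * M" by simp
  with 1 show ?thesis by simp
qed

section \<open>The index of the identity\<close>

text \<open>The two real coordinates \<open>a \<bullet> p\<close> and \<open>- (mult_i a \<bullet> p) = a \<bullet> mult_i p\<close> have the same second moment, so the
  squared modulus of the Hermitian product of \<open>a\<close> and \<open>p\<close> has mean \<open>(a \<bullet> a) / CARD('m)\<close>.\<close>

lemma second_variation_test_field:
  fixes a :: "complex ^ 'm::finite"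
  shows "real CARD('m) * second_variation (test_field a) =
    - 2 * (real CARD('m) - 1)\<^sup>2 * (a \<bullet> a) * measure (sphere_volume :: (complex ^ 'm) measure) usphere"
proof -
  interpret finite_measure "sphere_volume :: (complex ^ 'm) measure" by (rule finite_measure_sphere_volume)
  let ?vol = "measure (sphere_volume :: (complex ^ 'm) measure) usphere" and ?m = "real CARD('m)"
  have int: "integrable sphere_volume (\<lambda>p. (b \<bullet> p)\<^sup>2)" for b :: "complex ^ 'm"
    by (intro integrable_sphere_volume continuous_intros)
  have "second_variation (test_field a) =
      (LINT p|sphere_volume. (4 * ?m - 2) * ((a \<bullet> p)\<^sup>2 + (mult_i a \<bullet> p)\<^sup>2) - 2 * ?m * (a \<bullet> a))"
    unfolding second_variation_def
    by (rule Bochner_Integration.integral_cong)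
      (simp_all add: space_sphere_volume second_variation_density_test_field inner_mult_i_left)
  also have "\<dots> = (4 * ?m - 2) * ((LINT p|sphere_volume. (a \<bullet> p)\<^sup>2)
      + (LINT p|sphere_volume. (mult_i a \<bullet> p)\<^sup>2)) - 2 * ?m * (a \<bullet> a) * ?vol"
    using int[of a] int[of "mult_i a"] by (simp add: space_sphere_volume)
  finally have sv: "second_variation (test_field a) = (4 * ?m - 2) *
      ((LINT p|sphere_volume. (a \<bullet> p)\<^sup>2) + (LINT p|sphere_volume. (mult_i a \<bullet> p)\<^sup>2))
      - 2 * ?m * (a \<bullet> a) * ?vol" .
  have "?m * ((LINT p|sphere_volume. (a \<bullet> p)\<^sup>2) + (LINT p|sphere_volume. (mult_i a \<bullet> p)\<^sup>2)) =
      (a \<bullet> a) * ?vol"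
    using sphere_volume_second_moment[of a] sphere_volume_second_moment[of "mult_i a"]
    by (simp add: inner_mult_i_mult_i distrib_left)
  then have "?m * second_variation (test_field a) =
      (4 * ?m - 2) * ((a \<bullet> a) * ?vol) - 2 * ?m * ?m * (a \<bullet> a) * ?vol"
    unfolding sv right_diff_distrib by (simp add: mult.left_commute mult.assoc)
  also have "\<dots> = - 2 * (?m - 1)\<^sup>2 * (a \<bullet> a) * ?vol"
    by (simp add: algebra_simps power2_eq_square)
  finally show ?thesis .
qed

lemma linear_test_field: "linear test_field"
  by (rule linearI)
    (auto simp: test_field_def fun_eq_iff scaleR_fun_def inner_add_left algebra_simps)

lemma second_variation_test_field_neg:
  fixes a :: "complex ^ 'm::finite"
  assumes "CARD('m) \<ge> 2" "a \<noteq> 0"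
  shows "second_variation (test_field a) < 0"
proof -
  have "- 2 * (real CARD('m) - 1)\<^sup>2 * (a \<bullet> a) * measure (sphere_volume :: (complex ^ 'm) measure) usphere < 0"
    using assms measure_sphere_volume_pos[where 'a="complex ^ 'm"] by simp
  then show ?thesis
    unfolding second_variation_test_field[symmetric] by (simp add: mult_less_0_iff)
qed

lemma second_variation_zero: "second_variation (0 :: 'm::finite cfield) = 0"
proof -
  have "test_field (0 :: complex ^ 'm) = 0" by (rule linear_0[OF linear_test_field])
  then show ?thesis using second_variation_test_field[of "0 :: complex ^ 'm"] by simp
qed

theorem proposition5p11:
  fixes n :: nat
  assumes "CARD('m::finite) = n + 1" and "n \<ge> 1"
  shows "identity_index TYPE('m) \<ge> enat (2 * n + 2)"
proof -
  let ?W = "range (test_field :: complex ^ 'm \<Rightarrow> 'm cfield)"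
  let ?B = "test_field ` (Basis :: (complex ^ 'm) set)"
  have neg: "second_variation (test_field a) < 0" if "a \<noteq> 0" for a :: "complex ^ 'm"
    using second_variation_test_field_neg[OF _ that] assms by simp
  have inj: "inj (test_field :: complex ^ 'm \<Rightarrow> _)"
    unfolding linear_injective_0[OF linear_test_field]
    using neg second_variation_zero by (metis less_irrefl)
  have W: "?W = span ?B"
    by (simp add: linear_span_image[OF linear_test_field])
  have "dim ?W = card ?B"
    unfolding W
    by (intro dim_span_eq_card_independent linear_independent_injective_image[OF linear_test_field]
        independent_Basis) (simp add: inj)
  also have "\<dots> = 2 * n + 2"
    using card_image[OF inj_on_subset[OF inj subset_UNIV], of Basis] assms by simp
  finally have dim: "dim ?W = 2 * n + 2" .
  have "enat (dim ?W) \<le> identity_index TYPE('m)"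
    unfolding identity_index_def
  proof (intro Sup_upper CollectI exI conjI ballI impI)
    show "subspace ?W" unfolding W by (rule subspace_span)
    show "?W \<subseteq> vector_fields" using test_field_vector_field by blast
    show "finite ?B" by simp
    show "?W = span ?B" by (rule W)
    fix V assume "V \<in> ?W" "V \<noteq> 0"
    then show "second_variation V < 0"
      using neg linear_0[OF linear_test_field] by (metis imageE)
  qed (rule refl)
  then show ?thesis by (simp add: dim)
qed

end
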